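(* Let $\phi:\mathbb{C}_0\to\mathbb{C}$ be a non-constant analytic function of the form $\phi(s)=c_0s+\varphi(s)$ with $c_0\in\mathbb{N}_0$ and $\varphi\in\mathcal{D}$. For a positive integer $n$ write $n^{-\phi}$ for the function $s\mapsto n^{-\phi(s)}=\exp(-\phi(s)\log n)$. Then: (a)(i) If $\phi(\mathbb{C}_0)\subseteq\overline{\mathbb{C}_0}$ and $f\circ\phi\in\mathcal{A}^+$ for every $f\in\mathcal{A}^+$ (i.e. $C_\phi f=f\circ\phi$ maps $\mathcal{A}^+$ into itself), then $n^{-\phi}\in\mathcal{A}^+$ for every $n\ge1$ and there is a constant $C>0$ independent of $n$ with $\|n^{-\phi}\|_{\mathcal{A}^+}\le C$ for $n=1,2,\dots$. (ii) Conversely, if $n^{-\phi}\in\mathcal{A}^+$ for all $n\ge1$ and $(n^{-\phi})_{n\ge1}$ is a bounded sequence in $\mathcal{A}^+$, then $\phi$ maps $\mathbb{C}_0$ into $\mathbb{C}_0$ and $C_\phi$ is a bounded composition operator on $\mathcal{A}^+$. (b)(i) $C_\phi$ maps $\mathcal{A}^+$ into itself and is a compact operator $\mathcal{A}^+\to\mathcal{A}^+$ if and only if $n^{-\phi}\in\mathcal{A}^+$ for all $n$ and $\|n^{-\phi}\|_{\mathcal{A}^+}\to0$ as $n\to\infty$. In that case, $\phi(\mathbb{C}_0)\subseteq\mathbb{C}_\delta$ for some $\delta>0$. (ii) Assume that $\phi(s)=c_0s+\sum_{n\ge1}c_n n^{-s}$ with $\sum_{n\ge1}|c_n|<+\infty$.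 Then $C_\phi$ is a compact operator on $\mathcal{A}^+$ if and only if $\phi(\mathbb{C}_0)\subseteq\mathbb{C}_\delta$ for some $\delta>0$.
   Context: For $\theta\in\mathbb{R}$, $\mathbb{C}_\theta=\{s\in\mathbb{C}:\operatorname{Re}s>\theta\}$. The Wiener–Dirichlet algebra $\mathcal{A}^+$ is the set of functions $f(s)=\sum_{n\ge1}a_n n^{-s}$ with $\|f\|_{\mathcal{A}^+}=\sum_{n\ge1}|a_n|<\infty$, viewed as functions on $\{\operatorname{Re}s\ge0\}$ (where the series converge absolutely); it is a commutative unital Banach algebra under pointwise multiplication. $\mathcal{D}$ denotes the space of analytic functions $\mathbb{C}_0\to\mathbb{C}$ representable by a convergent Dirichlet series $\sum_{n\ge1}c_n n^{-s}$ for $\operatorname{Re}s$ large enough. $\mathbb{N}_0=\{0,1,2,\dots\}$. The composition operator is $C_\phi f=f\circ\phi$. *)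

theory Defs
  imports "HOL-Analysis.Analysis"
begin

definition halfplane :: "real \<Rightarrow> complex set" where
  "halfplane \<theta> = {s. Re s > \<theta>}"

text \<open>Dirichlet series sum_{n>=1} a n * n^(-s); the n = 0 term vanishes since 0 powr z = 0.\<close>
definition dirichlet :: "(nat \<Rightarrow> complex) \<Rightarrow> complex \<Rightarrow> complex" where
  "dirichlet a s = (\<Sum>n. a n * (of_nat n) powr (- s))"

definition Aplus :: "(complex \<Rightarrow> complex) set" where
  "Aplus = {f. \<exists>a. a 0 = 0 \<and> summable (\<lambda>n. norm (a n)) \<and>
                  (\<forall>s. Re s \<ge> 0 \<longrightarrow> f s = dirichlet a s)}"

definition dser_rep :: "(nat \<Rightarrow> complex) \<Rightarrow> (complex \<Rightarrow> complex) \<Rightarrow> bool" where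
  "dser_rep a g \<longleftrightarrow> a 0 = 0 \<and> summable (\<lambda>n. norm (a n)) \<and>
                     (\<forall>s. Re s > 0 \<longrightarrow> g s = dirichlet a s)"

text \<open>A function defined on C_0 belongs to A+ (coincides on C_0 with an element of A+).\<close>
definition in_Aplus :: "(complex \<Rightarrow> complex) \<Rightarrow> bool" where
  "in_Aplus g \<longleftrightarrow> (\<exists>a. dser_rep a g)"

text \<open>The A+ norm: sum of the moduli of the (unique) Dirichlet coefficients.\<close>
definition Aplus_norm :: "(complex \<Rightarrow> complex) \<Rightarrow> real" where
  "Aplus_norm g = Inf {r. \<exists>a. dser_rep a g \<and> r = (\<Sum>n. norm (a n))}"

definition Dclass :: "(complex \<Rightarrow> complex) set" where
  "Dclass = {f. f holomorphic_on halfplane 0 \<and>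
     (\<exists>c \<sigma>. \<forall>s. Re s > \<sigma> \<longrightarrow> (\<lambda>n. c n * (of_nat n) powr (- s)) sums f s)}"

definition npow :: "(complex \<Rightarrow> complex) \<Rightarrow> nat \<Rightarrow> complex \<Rightarrow> complex" where
  "npow \<phi> n = (\<lambda>s. (of_nat n) powr (- \<phi> s))"

definition Cphi_maps_Aplus :: "(complex \<Rightarrow> complex) \<Rightarrow> bool" where
  "Cphi_maps_Aplus \<phi> \<longleftrightarrow> \<phi> ` halfplane 0 \<subseteq> {s. Re s \<ge> 0} \<and>
     (\<forall>f\<in>Aplus. in_Aplus (f \<circ> \<phi>))"

definition Cphi_bounded :: "(complex \<Rightarrow> complex) \<Rightarrow> bool" where
  "Cphi_bounded \<phi> \<longleftrightarrow> Cphi_maps_Aplus \<phi> \<and>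
     (\<exists>C. \<forall>f\<in>Aplus. Aplus_norm (f \<circ> \<phi>) \<le> C * Aplus_norm f)"

definition Cphi_compact :: "(complex \<Rightarrow> complex) \<Rightarrow> bool" where
  "Cphi_compact \<phi> \<longleftrightarrow> Cphi_maps_Aplus \<phi> \<and>
     (\<forall>F :: nat \<Rightarrow> complex \<Rightarrow> complex. (\<forall>k. F k \<in> Aplus \<and> Aplus_norm (F k) \<le> 1) \<longrightarrow>
        (\<exists>(r :: nat \<Rightarrow> nat) g. strict_mono r \<and> in_Aplus g \<and>
           (\<lambda>k. Aplus_norm (\<lambda>s. F (r k) (\<phi> s) - g s)) \<longlonglongrightarrow> 0))"

end

theory Submission
  imports Defs "HOL-Complex_Analysis.Complex_Analysis"
begin

text \<open>
  Means over vertical arithmetic progressions recover the coefficients of an absolutely convergent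
  Dirichlet series, so each coefficient is bounded by the supremum of the function. Hence the
  coefficients of \<open>f \<circ> \<phi> = \<Sum> a\<^sub>n n\<^bsup>-\<phi>\<^esup>\<close> are obtained termwise, and a gliding hump shows that the norms of
  \<open>n\<^bsup>-\<phi>\<^esup>\<close> are bounded once \<open>C\<^sub>\<phi>\<close> is defined on all of \<open>A\<^sup>+\<close>. If these norms tend to 0, a coefficientwise
  convergent subsequence of a bounded sequence has norm convergent images. Conversely \<open>n\<^bsup>-\<phi>\<^esup>\<close> tends to 0
  pointwise, because \<open>\<phi>\<close> is open and so maps into the open half-plane; under compactness it therefore
  tends to 0 in norm.

  For \<open>\<phi>(s) = c\<^sub>0 s + \<psi>(s)\<close> with \<open>\<psi>\<close> absolutely convergent and \<open>Re \<phi> > \<delta>\<close>, the norm of \<open>n\<^bsup>-\<phi>\<^esup>\<close> is that of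
  \<open>exp(-t \<psi>)\<close> with \<open>t = log n\<close>. Replacing \<open>\<psi>\<close> by a Dirichlet polynomial and moving the line slightly to the
  left of 0, the coefficient bound gives \<open>exp(-t \<delta>') n\<^bsup>-\<epsilon>\<^esup>\<close> for the \<open>n\<close>-th coefficient. These coefficients
  live on smooth numbers, over which \<open>n\<^bsup>-\<epsilon>\<^esup>\<close> is summable.
\<close>

subsection \<open>Coefficients of absolutely convergent Dirichlet series\<close>

text \<open>Fubini for a double series whose rows have norm sums dominated by a summable
  \<open>r\<close>. Every finite part of row \<open>k\<close> is at most \<open>r k\<close>, which
  controls the columns; the interchange is Tannery's theorem for the partial sums over
  \<open>n\<close>.\<close>

lemma suminf_swap_dominated:
  fixes a :: "nat \<Rightarrow> nat \<Rightarrow> 'a::{banach, real_normed_algebra}"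
  assumes row: "\<And>k. summable (\<lambda>n. norm (a k n))"
    and le: "\<And>k. (\<Sum>n. norm (a k n)) \<le> r k" and r: "summable r"
  shows "summable (\<lambda>k. norm (a k n))"
    and "summable (\<lambda>n. norm (\<Sum>k. a k n))"
    and "(\<Sum>n. norm (\<Sum>k. a k n)) \<le> (\<Sum>k. r k)"
    and "(\<Sum>n. \<Sum>k. a k n) = (\<Sum>k. \<Sum>n. a k n)"
proof -
  have part: "(\<Sum>n\<in>A. norm (a k n)) \<le> r k" if "finite A" for k A
    by (rule order_trans[OF sum_le_suminf[OF row that] le]) auto
  have col: "summable (\<lambda>k. norm (a k n))" for n
    by (rule summable_comparison_test'[OF r, of 0]) (use part[of "{n}"] in auto)
  show "summable (\<lambda>k. norm (a k n))" by (rule col)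
  have bd: "(\<Sum>n<N. norm (\<Sum>k. a k n)) \<le> (\<Sum>k. r k)" for N
  proof -
    have "(\<Sum>n<N. norm (\<Sum>k. a k n)) \<le> (\<Sum>n<N. \<Sum>k. norm (a k n))"
      by (intro sum_mono summable_norm col)
    also have "\<dots> = (\<Sum>k. \<Sum>n<N. norm (a k n))"
      by (rule suminf_sum[symmetric]) (rule col)
    also have "\<dots> \<le> (\<Sum>k. r k)"
      by (intro suminf_le part r summable_sum col) auto
    finally show ?thesis .
  qed
  show sm: "summable (\<lambda>n. norm (\<Sum>k. a k n))"
    by (rule summableI_nonneg_bounded[OF _ bd]) auto
  show "(\<Sum>n. norm (\<Sum>k. a k n)) \<le> (\<Sum>k. r k)"
    by (rule suminf_le_const[OF sm bd])
  have "((\<lambda>N. \<Sum>k. \<Sum>n<N. a k n) \<longlongrightarrow> (\<Sum>k. \<Sum>n. a k n)) sequentially"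
  proof (rule tannerys_theorem[THEN conjunct2, THEN conjunct2])
    show "(\<lambda>N. \<Sum>n<N. a k n) \<longlonglongrightarrow> (\<Sum>n. a k n)" for k
      by (rule summable_LIMSEQ[OF summable_norm_cancel[OF row]])
    have "norm (\<Sum>n<N. a k n) \<le> r k" for k N
      by (rule order_trans[OF norm_sum part]) simp
    then show "\<forall>\<^sub>F (k, N) in sequentially \<times>\<^sub>F sequentially. norm (\<Sum>n<N. a k n) \<le> r k"
      by (simp add: case_prod_unfold)
  qed (use r in auto)
  moreover have "(\<Sum>k. \<Sum>n<N. a k n) = (\<Sum>n<N. \<Sum>k. a k n)" for N
    by (rule suminf_sum) (rule summable_norm_cancel[OF col])
  ultimately have "(\<lambda>n. \<Sum>k. a k n) sums (\<Sum>k. \<Sum>n. a k n)"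
    by (simp add: sums_def)
  then show "(\<Sum>n. \<Sum>k. a k n) = (\<Sum>k. \<Sum>n. a k n)"
    by (rule sums_unique[symmetric])
qed

lemma norm_of_nat_powr:
  "norm ((of_nat n :: complex) powr z) = real n powr Re z"
  by (subst norm_powr_real_powr) auto

lemma of_nat_mult_powr:
  "(of_nat (m * n) :: complex) powr z = of_nat m powr z * of_nat n powr z"
  unfolding of_nat_mult by (rule powr_times_real) auto

lemma real_nat_powr_le_1:
  assumes "x \<le> 0"
  shows "real n powr x \<le> 1"
  using assms powr_mono[of x 0 "real n"] by (cases "n = 0") auto

lemma norm_of_nat_powr_uminus_le_1:
  assumes "0 \<le> Re s"
  shows "norm ((of_nat n :: complex) powr (- s)) \<le> 1"
  using assms by (simp add: norm_of_nat_powr real_nat_powr_le_1)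

lemma norm_dirichlet_term_le:
  assumes "0 \<le> Re s"
  shows "norm (a n * of_nat n powr (- s)) \<le> norm (a n)"
  using mult_left_mono[OF norm_of_nat_powr_uminus_le_1[OF assms], of "norm (a n)"]
  by (simp add: norm_mult)

lemma
  assumes "summable (\<lambda>n. norm (a n))" "0 \<le> Re s"
  shows dirichlet_abs_summable: "summable (\<lambda>n. norm (a n * of_nat n powr (- s)))"
    and norm_dirichlet_le: "norm (dirichlet a s) \<le> (\<Sum>n. norm (a n))"
proof -
  show sm: "summable (\<lambda>n. norm (a n * of_nat n powr (- s)))"
    by (rule summable_comparison_test'[OF assms(1), of 0])
      (use norm_dirichlet_term_le[OF assms(2)] in auto)
  have "norm (dirichlet a s) \<le> (\<Sum>n. norm (a n * of_nat n powr (- s)))"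
    unfolding dirichlet_def by (rule summable_norm[OF sm])
  also have "\<dots> \<le> (\<Sum>n. norm (a n))"
    by (intro suminf_le norm_dirichlet_term_le assms sm)
  finally show "norm (dirichlet a s) \<le> (\<Sum>n. norm (a n))" .
qed

lemma dirichlet_sums:
  assumes "summable (\<lambda>n. norm (a n))" "0 \<le> Re s"
  shows "(\<lambda>n. a n * of_nat n powr (- s)) sums dirichlet a s"
  unfolding dirichlet_def
  by (rule summable_sums[OF summable_norm_cancel[OF dirichlet_abs_summable[OF assms]]])

section \<open>Linear combinations and infinite series of represented functions\<close>

lemma dser_rep_add:
  assumes "dser_rep a f" "dser_rep b g"
  shows "dser_rep (\<lambda>n. a n + b n) (\<lambda>s. f s + g s)"
  unfolding dser_rep_def
proof (intro conjI allI impI)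
  show "a 0 + b 0 = 0" using assms by (simp add: dser_rep_def)
  show "summable (\<lambda>n. norm (a n + b n))"
    by (rule summable_comparison_test'[OF summable_add, of "\<lambda>n. norm (a n)" "\<lambda>n. norm (b n)" 0])
      (use assms in \<open>auto simp: dser_rep_def norm_triangle_ineq\<close>)
  fix s :: complex assume "0 < Re s"
  then have "(\<lambda>n. a n * of_nat n powr (- s) + b n * of_nat n powr (- s)) sums (f s + g s)"
    using assms by (intro sums_add) (auto simp: dser_rep_def dirichlet_sums)
  then show "f s + g s = dirichlet (\<lambda>n. a n + b n) s"
    unfolding dirichlet_def by (simp add: sums_iff ring_distribs)
qed

lemma dser_rep_cmult:
  assumes "dser_rep a f"
  shows "dser_rep (\<lambda>n. c * a n) (\<lambda>s. c * f s)"
  unfolding dser_rep_def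
proof (intro conjI allI impI)
  show "c * a 0 = 0" using assms by (simp add: dser_rep_def)
  show "summable (\<lambda>n. norm (c * a n))"
    using assms by (auto simp: dser_rep_def norm_mult intro: summable_mult)
  fix s :: complex assume "0 < Re s"
  then have "(\<lambda>n. c * (a n * of_nat n powr (- s))) sums (c * f s)"
    using assms by (intro sums_mult) (auto simp: dser_rep_def dirichlet_sums)
  then show "c * f s = dirichlet (\<lambda>n. c * a n) s"
    unfolding dirichlet_def by (simp add: sums_iff mult.assoc)
qed

lemma dser_rep_zero: "dser_rep (\<lambda>_. 0) (\<lambda>_. 0)"
  by (simp add: dser_rep_def dirichlet_def)

lemma dser_rep_diff:
  assumes "dser_rep a f" "dser_rep b g"
  shows "dser_rep (\<lambda>n. a n - b n) (\<lambda>s. f s - g s)"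
  using dser_rep_add[OF assms(1) dser_rep_cmult[OF assms(2), of "-1"]] by simp

lemma dser_rep_sum:
  assumes "\<And>i. i \<in> I \<Longrightarrow> dser_rep (a i) (f i)"
  shows "dser_rep (\<lambda>n. \<Sum>i\<in>I. a i n) (\<lambda>s. \<Sum>i\<in>I. f i s)"
  using assms
proof (induction I rule: infinite_finite_induct)
  case (insert x F)
  then show ?case using dser_rep_add[of "a x" "f x"] by simp
qed (simp_all add: dser_rep_zero)

lemma dser_rep_cong:
  assumes "dser_rep a f" "\<And>s. 0 < Re s \<Longrightarrow> f s = g s"
  shows "dser_rep a g"
  using assms by (simp add: dser_rep_def)

text \<open>Completeness of A+ enters in this form: a series with summable norm bounds may be summed
  coefficientwise. The interchange is used twice, for the coefficients and for the terms at a fixed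
  \<open>s\<close>.\<close>

lemma dser_rep_suminf:
  assumes rep: "\<And>k. dser_rep (a k) (g k)"
    and le: "\<And>k. (\<Sum>n. norm (a k n)) \<le> r k" and r: "summable r"
  shows "dser_rep (\<lambda>n. \<Sum>k. a k n) (\<lambda>s. \<Sum>k. g k s)"
    and "(\<Sum>n. norm (\<Sum>k. a k n)) \<le> (\<Sum>k. r k)"
proof -
  have sm: "summable (\<lambda>n. norm (a k n))" for k
    using rep by (simp add: dser_rep_def)
  note sw = suminf_swap_dominated[of a, OF sm le r]
  show "(\<Sum>n. norm (\<Sum>k. a k n)) \<le> (\<Sum>k. r k)" by (rule sw(3))
  show "dser_rep (\<lambda>n. \<Sum>k. a k n) (\<lambda>s. \<Sum>k. g k s)"
    unfolding dser_rep_def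
  proof (intro conjI allI impI)
    show "(\<Sum>k. a k 0) = 0" using rep by (simp add: dser_rep_def)
    show "summable (\<lambda>n. norm (\<Sum>k. a k n))" by (rule sw(2))
    fix s :: complex assume s: "0 < Re s"
    let ?b = "\<lambda>k n. a k n * of_nat n powr (- s)"
    have sm': "summable (\<lambda>n. norm (?b k n))" for k
      using dirichlet_abs_summable[OF sm] s by simp
    have le': "(\<Sum>n. norm (?b k n)) \<le> r k" for k
      by (rule order_trans[OF suminf_le[OF _ sm' sm] le]) (use s in \<open>simp add: norm_dirichlet_term_le\<close>)
    have "(\<Sum>k. g k s) = (\<Sum>k. \<Sum>n. ?b k n)"
      using rep s by (simp add: dser_rep_def dirichlet_def)
    also have "\<dots> = (\<Sum>n. \<Sum>k. ?b k n)"
      by (rule suminf_swap_dominated(4)[OF sm' le' r, symmetric])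
    also have "\<dots> = dirichlet (\<lambda>n. \<Sum>k. a k n) s"
      unfolding dirichlet_def
      by (simp add: suminf_mult2[OF summable_norm_cancel[OF sw(1)], symmetric])
    finally show "(\<Sum>k. g k s) = dirichlet (\<lambda>n. \<Sum>k. a k n) s" .
  qed
qed

section \<open>Coefficients from means along vertical lines\<close>

lemma exists_generic_step:
  "\<exists>h::real. \<forall>m n::nat. 0 < m \<longrightarrow> 0 < n \<longrightarrow> m \<noteq> n \<longrightarrow> cis (h * ln (real m / real n)) \<noteq> 1"
proof -
  \<comment> \<open>All steps that give the \<open>cis\<close> value 1 for some admissible pair lie
    in this set; pairs with vanishing logarithm only contribute 0. It is countable, so some real
    step avoids it.\<close>
  let ?B = "(\<lambda>(m::nat, n::nat, k::int). 2 * pi * of_int k / ln (real m / real n)) ` UNIV"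
  have "countable ?B" by blast
  then have "?B \<noteq> UNIV" using uncountable_UNIV_real by metis
  then obtain h where h: "h \<notin> ?B" by blast
  have "cis (h * ln (real m / real n)) \<noteq> 1" if "0 < m" "0 < n" "m \<noteq> n" for m n :: nat
  proof
    assume "cis (h * ln (real m / real n)) = 1"
    then have "cos (h * ln (real m / real n)) = 1"
      by (metis cis.sel(1) one_complex.sel(1))
    then obtain k :: int where "h * ln (real m / real n) = of_int k * 2 * pi"
      using cos_one_2pi_int by blast
    moreover have "ln (real m / real n) \<noteq> 0" using that by simp
    ultimately have "h = 2 * pi * of_int k / ln (real m / real n)"
      by (simp add: field_simps)
    then show False using h by (auto simp: image_iff)
  qed
  then show ?thesis by blast
qed

lemma mean_powers_tendsto_0:
  fixes w :: complex
  assumes "norm w = 1" "w \<noteq> 1"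
  shows "(\<lambda>T. (\<Sum>k<T. w ^ k) / of_nat T) \<longlonglongrightarrow> 0"
proof (rule Lim_null_comparison)
  have "norm ((\<Sum>k<T. w ^ k) / of_nat T) \<le> (2 / norm (w - 1)) / real T" for T
  proof -
    have "norm (w ^ T - 1) \<le> 2"
      using norm_triangle_ineq4[of "w ^ T" 1] assms by (simp add: norm_power)
    then have "norm (\<Sum>k<T. w ^ k) \<le> 2 / norm (w - 1)"
      using assms by (simp add: geometric_sum norm_divide divide_right_mono)
    then have "norm (\<Sum>k<T. w ^ k) / real T \<le> (2 / norm (w - 1)) / real T"
      by (rule divide_right_mono) simp
    then show ?thesis by (simp add: norm_divide)
  qed
  then show "\<forall>\<^sub>F T in sequentially. norm ((\<Sum>k<T. w ^ k) / of_nat T) \<le> (2 / norm (w - 1)) / real T"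
    by simp
  show "(\<lambda>T. (2 / norm (w - 1)) / real T) \<longlonglongrightarrow> 0"
    by (rule lim_const_over_n)
qed

lemma of_nat_powr_Complex:
  assumes "0 < n"
  shows "(of_nat n :: complex) powr (Complex x y) = of_real (real n powr x) * cis (y * ln (real n))"
proof -
  have "(of_nat n :: complex) powr (Complex x y) = exp (of_real (ln (real n)) * Complex x y)"
    using assms by (simp add: powr_def Ln_of_nat mult.commute)
  also have "of_real (ln (real n)) * Complex x y = Complex (ln (real n) * x) (ln (real n) * y)"
    by (simp add: complex_eq_iff)
  also have "exp \<dots> = of_real (real n powr x) * cis (y * ln (real n))"
    using assms by (simp add: exp_eq_polar powr_def mult.commute)
  finally show ?thesis .
qed

text \<open>The discrete mean of \<open>g(s) m\<^sup>s\<close> over the points \<open>\<sigma> + \<i>kh\<close> isolates the \<open>m\<close>-th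
  coefficient, because for generic \<open>h\<close> all ratios \<open>(m/n)\<^bsup>\<i>h\<^esup>\<close> with \<open>n \<noteq> m\<close> differ from 1.\<close>

lemma dser_rep_coeff_bound_line:
  assumes rep: "dser_rep a g" and \<sigma>: "0 < \<sigma>"
    and K: "\<And>s. Re s = \<sigma> \<Longrightarrow> norm (g s) \<le> K" and m: "0 < m"
  shows "norm (a m) \<le> K * real m powr \<sigma>"
proof -
  have sm: "summable (\<lambda>n. norm (a n))" and a0: "a 0 = 0"
    using rep by (auto simp: dser_rep_def)
  obtain h :: real where h: "\<And>m n. 0 < m \<Longrightarrow> 0 < n \<Longrightarrow> m \<noteq> n \<Longrightarrow> cis (h * ln (real m / real n)) \<noteq> 1"
    using exists_generic_step by blast
  define p where "p = (\<lambda>k::nat. Complex \<sigma> (h * real k))"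
  define w where "w = (\<lambda>n. cis (h * ln (real m / real n)))"
  define q where "q = (\<lambda>n. (real m / real n) powr \<sigma>)"
  have term_eq: "a n * of_nat n powr (- p k) * of_nat m powr (p k) = a n * of_real (q n) * w n ^ k" for n k
  proof (cases "n = 0")
    case False
    have "of_nat n powr (- p k) * of_nat m powr (p k) =
      of_real (real n powr (- \<sigma>)) * cis (- (h * real k) * ln (real n)) *
      (of_real (real m powr \<sigma>) * cis (h * real k * ln (real m)))"
      using m False of_nat_powr_Complex[of n "- \<sigma>" "- (h * real k)"]
        of_nat_powr_Complex[of m \<sigma> "h * real k"]
      by (simp add: p_def complex_minus)
    also have "\<dots> = of_real (real n powr (- \<sigma>) * real m powr \<sigma>) *
        (cis (- (h * real k) * ln (real n)) * cis (h * real k * ln (real m)))"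
      by simp
    also have "real n powr (- \<sigma>) * real m powr \<sigma> = q n"
      using False m by (simp add: q_def powr_divide powr_minus_divide)
    also have "cis (- (h * real k) * ln (real n)) * cis (h * real k * ln (real m)) = w n ^ k"
      using False m unfolding w_def Complex.DeMoivre cis_mult
      by (simp add: ln_div algebra_simps)
    finally show ?thesis by (simp add: mult.assoc)
  qed (simp add: a0)
  have q_le: "q n \<le> real m powr \<sigma>" for n
  proof (cases "n = 0")
    case False
    then have "real m / real n \<le> real m / 1" by (intro divide_left_mono) auto
    then show ?thesis using \<sigma> unfolding q_def by (intro powr_mono2) auto
  qed (use m \<sigma> in \<open>simp add: q_def\<close>)
  have norm_w: "norm (w n) = 1" for n by (simp add: w_def)
  \<comment> \<open>\<open>A n T\<close> is what the \<open>n\<close>-th term of the series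
    contributes to the mean of \<open>g s * of_nat m powr s\<close> over the first \<open>T\<close>
    points \<open>p k\<close>. The bound \<open>q_le\<close> supplies the majorant independent of
    \<open>T\<close> that lets the limit pass through the sum over \<open>n\<close>.\<close>
  define A where "A = (\<lambda>n T. a n * of_real (q n) * ((\<Sum>k<T. w n ^ k) / of_nat T))"
  have "(\<lambda>T. \<Sum>n. A n T) \<longlonglongrightarrow> (\<Sum>n. if n = m then a m else 0)"
  proof (rule tannerys_theorem[THEN conjunct2, THEN conjunct2])
    show "A n \<longlonglongrightarrow> (if n = m then a m else 0)" for n
    proof (cases "n = m")
      case True
      have "\<forall>\<^sub>F T in sequentially. a m = A n T"
        using eventually_gt_at_top[of 0]
        by eventually_elim (use True m in \<open>simp add: A_def q_def w_def\<close>)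
      then have "A n \<longlonglongrightarrow> a m"
        by (rule Lim_transform_eventually[OF tendsto_const])
      then show ?thesis using True by simp
    next
      case False
      show ?thesis
      proof (cases "n = 0")
        case True
        then show ?thesis using m by (simp add: A_def a0)
      next
        case n: False
        have "(\<lambda>T. (\<Sum>k<T. w n ^ k) / of_nat T) \<longlonglongrightarrow> 0"
          by (rule mean_powers_tendsto_0[OF norm_w]) (use h[of m n] False m n in \<open>auto simp: w_def\<close>)
        then have "A n \<longlonglongrightarrow> a n * of_real (q n) * 0"
          unfolding A_def by (intro tendsto_intros)
        then show ?thesis using False by simp
      qed
    qed
    have "norm (A n T) \<le> norm (a n) * real m powr \<sigma>" for n T
    proof -
      have "norm (\<Sum>k<T. w n ^ k) \<le> real T"
        using norm_sum[of "\<lambda>k. w n ^ k" "{..<T}"] by (simp add: norm_power norm_w)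
      then have "norm ((\<Sum>k<T. w n ^ k) / of_nat T) \<le> 1"
        by (cases "T = 0") (simp_all add: norm_divide)
      then have "norm (A n T) \<le> norm (a n) * q n * 1"
        unfolding A_def norm_mult by (intro mult_mono) (auto simp: q_def)
      also have "\<dots> \<le> norm (a n) * real m powr \<sigma>"
        using q_le by (simp add: mult_left_mono)
      finally show ?thesis .
    qed
    then show "\<forall>\<^sub>F (n, T) in sequentially \<times>\<^sub>F sequentially. norm (A n T) \<le> norm (a n) * real m powr \<sigma>"
      by (simp add: case_prod_unfold)
    show "summable (\<lambda>n. norm (a n) * real m powr \<sigma>)"
      by (rule summable_mult2[OF sm])
  qed simp
  moreover have "(\<Sum>n. if n = m then a m else 0) = a m"
    by (subst suminf_finite[of "{m}"]) auto
  moreover have "norm (\<Sum>n. A n T) \<le> K * real m powr \<sigma>" if "0 < T" for T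
  proof -
    have "(\<lambda>n. a n * of_real (q n) * w n ^ k) sums (g (p k) * of_nat m powr (p k))" for k
    proof -
      have "(\<lambda>n. a n * of_nat n powr (- p k)) sums g (p k)"
        using dirichlet_sums[OF sm, of "p k"] rep \<sigma> by (simp add: p_def dser_rep_def)
      then have "(\<lambda>n. a n * of_nat n powr (- p k) * of_nat m powr (p k)) sums (g (p k) * of_nat m powr (p k))"
        by (rule sums_mult2)
      then show ?thesis by (simp add: term_eq)
    qed
    then have "(\<lambda>n. (\<Sum>k<T. a n * of_real (q n) * w n ^ k) / of_nat T) sums
        ((\<Sum>k<T. g (p k) * of_nat m powr (p k)) / of_nat T)"
      by (intro sums_divide sums_sum)
    then have "(\<Sum>n. A n T) = (\<Sum>k<T. g (p k) * of_nat m powr (p k)) / of_nat T"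
      by (simp add: A_def sums_iff sum_distrib_left)
    moreover have "norm (\<Sum>k<T. g (p k) * of_nat m powr (p k)) \<le> (\<Sum>k<T. K * real m powr \<sigma>)"
      by (rule sum_norm_le)
        (use K in \<open>simp add: norm_mult norm_of_nat_powr p_def mult_right_mono\<close>)
    ultimately show ?thesis using that by (simp add: norm_divide pos_divide_le_eq mult_ac)
  qed
  then have "\<forall>\<^sub>F T in sequentially. norm (\<Sum>n. A n T) \<le> K * real m powr \<sigma>"
    by (rule eventually_mono[OF eventually_gt_at_top[of 0]])
  ultimately show ?thesis
    using tendsto_upperbound[OF tendsto_norm, of "\<lambda>T. \<Sum>n. A n T" "a m" sequentially] by simp
qed

text \<open>Only the behaviour as \<open>Re s \<rightarrow> 0\<close> matters, so an exponential growth factor in \<open>Re s\<close> is harmless.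
  This takes the place of a Phragmen-Lindelof argument when \<open>c\<^sub>0 > 0\<close>.\<close>

lemma dser_rep_coeff_bound:
  assumes rep: "dser_rep a g" and K: "\<And>s. 0 < Re s \<Longrightarrow> norm (g s) \<le> K * exp (C * Re s)"
  shows "norm (a m) \<le> K"
proof (cases "m = 0")
  case True
  \<comment> \<open>Since \<open>a 0 = 0\<close>, the claim is only \<open>0 \<le> K\<close>, and
    the value at 1 forces it.\<close>
  have "0 \<le> norm (g 1)" by simp
  also have "\<dots> \<le> K * exp C" using K[of 1] by simp
  finally show ?thesis using True rep by (simp add: dser_rep_def zero_le_mult_iff)
next
  case False
  \<comment> \<open>Both \<open>exp (C * \<sigma>)\<close> and \<open>real m powr \<sigma>\<close>
    tend to 1 as the line approaches the imaginary axis.\<close>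
  have "((\<lambda>\<sigma>. K * exp (C * \<sigma>) * real m powr \<sigma>) \<longlongrightarrow> K * exp (C * 0) * real m powr 0) (at_right 0)"
    using False by (intro tendsto_intros) auto
  moreover have "\<forall>\<^sub>F \<sigma> in at_right 0. norm (a m) \<le> K * exp (C * \<sigma>) * real m powr \<sigma>"
    using eventually_at_right_less[of 0]
  proof eventually_elim
    case (elim \<sigma>)
    show ?case by (rule dser_rep_coeff_bound_line[OF rep elim]) (use K elim False in auto)
  qed
  ultimately show ?thesis
    using tendsto_lowerbound[of "\<lambda>\<sigma>. K * exp (C * \<sigma>) * real m powr \<sigma>" K "at_right 0" "norm (a m)"] False
    by simp
qed

text \<open>The difference represents the zero function, so the coefficient bound applies with
  \<open>K = 0\<close>.\<close>

lemma dser_rep_unique: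
  assumes "dser_rep a g" "dser_rep b g"
  shows "a = b"
proof
  fix m
  have "norm (a m - b m) \<le> 0"
    by (rule dser_rep_coeff_bound[OF dser_rep_diff[OF assms], of _ 0]) simp
  then show "a m = b m" by simp
qed

lemma Aplus_norm_eq:
  assumes "dser_rep a g"
  shows "Aplus_norm g = (\<Sum>n. norm (a n))"
proof -
  have "{r. \<exists>a. dser_rep a g \<and> r = (\<Sum>n. norm (a n))} = {\<Sum>n. norm (a n)}"
    using assms dser_rep_unique by blast
  then show ?thesis by (simp add: Aplus_norm_def)
qed

subsection \<open>Norm estimates\<close>

text \<open>Membership, an upper bound for the norm and the support of the coefficients are carried
  together. The set \<open>M\<close> keeps exponentials of Dirichlet polynomials on smooth numbers;
  it is \<open>UNIV\<close> where only the norm matters.\<close>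

definition Aplus_le :: "nat set \<Rightarrow> (complex \<Rightarrow> complex) \<Rightarrow> real \<Rightarrow> bool" where
  "Aplus_le M g r \<longleftrightarrow>
     (\<exists>a. dser_rep a g \<and> (\<forall>n. a n \<noteq> 0 \<longrightarrow> n \<in> M) \<and> (\<Sum>n. norm (a n)) \<le> r)"

lemma Aplus_leI:
  assumes "dser_rep a g" "\<And>n. a n \<noteq> 0 \<Longrightarrow> n \<in> M" "(\<Sum>n. norm (a n)) \<le> r"
  shows "Aplus_le M g r"
  using assms unfolding Aplus_le_def by blast

lemma Aplus_le_norm:
  assumes "in_Aplus g"
  shows "Aplus_le UNIV g (Aplus_norm g)"
  using assms unfolding in_Aplus_def Aplus_le_def by (auto simp: Aplus_norm_eq)

lemma
  assumes "Aplus_le M g r"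
  shows Aplus_le_imp_in_Aplus: "in_Aplus g"
    and Aplus_le_imp_norm_le: "Aplus_norm g \<le> r"
  using assms unfolding in_Aplus_def Aplus_le_def by (auto simp: Aplus_norm_eq)

lemma Aplus_le_mono:
  assumes "Aplus_le M g r" "M \<subseteq> M'" "r \<le> r'"
  shows "Aplus_le M' g r'"
  using assms unfolding Aplus_le_def by fastforce

lemma Aplus_le_cong:
  assumes "Aplus_le M f r" "\<And>s. 0 < Re s \<Longrightarrow> f s = g s"
  shows "Aplus_le M g r"
  using assms dser_rep_cong unfolding Aplus_le_def by blast

lemma Aplus_le_bound:
  assumes "Aplus_le M g r" "0 < Re s"
  shows "norm (g s) \<le> r"
proof -
  obtain a where a: "dser_rep a g" "(\<Sum>n. norm (a n)) \<le> r"
    using assms(1) unfolding Aplus_le_def by blast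
  then have "norm (g s) \<le> (\<Sum>n. norm (a n))"
    using assms(2) norm_dirichlet_le[of a s] by (simp add: dser_rep_def)
  then show ?thesis using a(2) by linarith
qed

lemma Aplus_le_nonneg: "Aplus_le M g r \<Longrightarrow> 0 \<le> r"
  using Aplus_le_bound[of M g r 1] norm_ge_zero[of "g 1"] by (simp del: norm_ge_zero)

lemma Aplus_le_cmult:
  assumes "Aplus_le M f p"
  shows "Aplus_le M (\<lambda>s. c * f s) (norm c * p)"
proof -
  obtain a where a: "dser_rep a f" "\<And>n. a n \<noteq> 0 \<Longrightarrow> n \<in> M" "(\<Sum>n. norm (a n)) \<le> p"
    using assms unfolding Aplus_le_def by blast
  have "(\<Sum>n. norm (c * a n)) = norm c * (\<Sum>n. norm (a n))"
    using a(1) by (simp add: norm_mult suminf_mult dser_rep_def)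
  also have "\<dots> \<le> norm c * p" using a(3) by (simp add: mult_left_mono)
  finally show ?thesis
    using a(2) by (intro Aplus_leI[OF dser_rep_cmult[OF a(1)]]) auto
qed

lemma Aplus_le_zero: "0 \<le> r \<Longrightarrow> Aplus_le M (\<lambda>_. 0) r"
  using dser_rep_zero unfolding Aplus_le_def by fastforce

lemma Aplus_le_suminf:
  assumes "\<And>k. Aplus_le M (g k) (r k)" "summable r"
  shows "Aplus_le M (\<lambda>s. \<Sum>k. g k s) (\<Sum>k. r k)"
proof -
  obtain a where a: "\<And>k. dser_rep (a k) (g k)" "\<And>k n. a k n \<noteq> 0 \<Longrightarrow> n \<in> M"
      "\<And>k. (\<Sum>n. norm (a k n)) \<le> r k"
    using assms(1) unfolding Aplus_le_def by metis
  note rep = dser_rep_suminf[OF a(1) a(3) assms(2)]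
  show ?thesis
  proof (rule Aplus_leI[OF rep(1) _ rep(2)])
    show "n \<in> M" if "(\<Sum>k. a k n) \<noteq> 0" for n
    proof (rule ccontr)
      assume "n \<notin> M"
      then have "(\<lambda>k. a k n) = (\<lambda>_. 0)" using a(2) by auto
      then show False using that by simp
    qed
  qed
qed

text \<open>The factor moves the coefficient at \<open>n\<close> to \<open>m * n\<close>. This
  reindexing is injective for \<open>0 < m\<close>, so the norm is preserved.\<close>

lemma Aplus_le_shift:
  assumes g: "Aplus_le M g r" and m: "m \<in> M" "0 < m"
    and M: "\<And>x y. x \<in> M \<Longrightarrow> y \<in> M \<Longrightarrow> x * y \<in> M"
  shows "Aplus_le M (\<lambda>s. of_nat m powr (- s) * g s) r"
proof -
  obtain a where a: "dser_rep a g" "\<And>n. a n \<noteq> 0 \<Longrightarrow> n \<in> M" "(\<Sum>n. norm (a n)) \<le> r"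
    using g unfolding Aplus_le_def by blast
  define b where "b k = (if m dvd k then a (k div m) else 0)" for k
  have b_mult: "b (m * n) = a n" for n using m by (simp add: b_def)
  have b_0: "b k = 0" if "k \<notin> range ((*) m)" for k
    using that unfolding b_def by (auto simp: dvd_def)
  have sm: "strict_mono ((*) m)" using m by (simp add: strict_mono_def)
  have "(\<lambda>n. norm (b n)) sums (\<Sum>n. norm (a n))"
    using a(1) sums_mono_reindex[OF sm, of "\<lambda>k. norm (b k)" "\<Sum>n. norm (a n)"]
    by (simp add: b_0 b_mult dser_rep_def summable_sums)
  then have nb: "summable (\<lambda>n. norm (b n))" "(\<Sum>n. norm (b n)) = (\<Sum>n. norm (a n))"
    by (auto simp: sums_iff)
  have rep: "dser_rep b (\<lambda>s. of_nat m powr (- s) * g s)"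
    unfolding dser_rep_def
  proof (intro conjI allI impI nb)
    show "b 0 = 0" using a(1) by (simp add: b_def dser_rep_def)
    fix s :: complex assume s: "0 < Re s"
    have "(\<lambda>n. of_nat m powr (- s) * (a n * of_nat n powr (- s))) sums (of_nat m powr (- s) * g s)"
      by (rule sums_mult) (use a(1) s dirichlet_sums[of a s] in \<open>simp add: dser_rep_def\<close>)
    also have "(\<lambda>n. of_nat m powr (- s) * (a n * of_nat n powr (- s))) =
        (\<lambda>n. b (m * n) * of_nat (m * n) powr (- s))"
      unfolding b_mult of_nat_mult_powr by (simp add: mult_ac)
    finally have "(\<lambda>k. b k * of_nat k powr (- s)) sums (of_nat m powr (- s) * g s)"
      using sums_mono_reindex[OF sm, of "\<lambda>k. b k * of_nat k powr (- s)"] b_0 by simp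
    then show "of_nat m powr (- s) * g s = dirichlet b s"
      by (simp add: dirichlet_def sums_iff)
  qed
  show ?thesis
  proof (rule Aplus_leI[OF rep])
    show "n \<in> M" if "b n \<noteq> 0" for n
      using that a(2)[of "n div m"] M[of m "n div m"] m by (auto simp: b_def split: if_splits)
    show "(\<Sum>n. norm (b n)) \<le> r" using nb(2) a(3) by simp
  qed
qed

text \<open>Submultiplicativity without handling a Dirichlet convolution: expand \<open>f\<close>,
  multiply each term by \<open>g\<close> through a shift, and sum the resulting series of
  functions.\<close>

lemma Aplus_le_mult:
  assumes f: "Aplus_le M f p" and g: "Aplus_le M g q"
    and M: "\<And>x y. x \<in> M \<Longrightarrow> y \<in> M \<Longrightarrow> x * y \<in> M"
  shows "Aplus_le M (\<lambda>s. f s * g s) (p * q)"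
proof -
  obtain a where a: "dser_rep a f" "\<And>n. a n \<noteq> 0 \<Longrightarrow> n \<in> M" "(\<Sum>n. norm (a n)) \<le> p"
    using f unfolding Aplus_le_def by blast
  have q: "0 \<le> q" by (rule Aplus_le_nonneg[OF g])
  have sm: "summable (\<lambda>n. norm (a n))" using a(1) by (simp add: dser_rep_def)
  have term_le: "Aplus_le M (\<lambda>s. a n * (of_nat n powr (- s) * g s)) (norm (a n) * q)" for n
  proof (cases "a n = 0")
    case True
    then show ?thesis by (simp add: Aplus_le_zero)
  next
    case False
    then have "0 < n" using a(1) by (cases n) (auto simp: dser_rep_def)
    then show ?thesis using False a(2) by (intro Aplus_le_cmult Aplus_le_shift g M)
  qed
  have "Aplus_le M (\<lambda>s. \<Sum>n. a n * (of_nat n powr (- s) * g s)) (\<Sum>n. norm (a n) * q)"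
    by (rule Aplus_le_suminf[OF term_le summable_mult2[OF sm]])
  then have "Aplus_le M (\<lambda>s. f s * g s) (\<Sum>n. norm (a n) * q)"
  proof (rule Aplus_le_cong)
    fix s :: complex assume s: "0 < Re s"
    then have "(\<lambda>n. a n * of_nat n powr (- s) * g s) sums (f s * g s)"
      using a(1) dirichlet_sums[of a s] by (intro sums_mult2) (simp add: dser_rep_def)
    then show "(\<Sum>n. a n * (of_nat n powr (- s) * g s)) = f s * g s"
      by (simp add: sums_iff mult.assoc)
  qed
  then show ?thesis
    by (rule Aplus_le_mono) (use a(3) q in \<open>auto simp: suminf_mult2[OF sm, symmetric] mult_right_mono\<close>)
qed

lemma
  fixes m :: nat
  shows summable_monomial: "summable (\<lambda>n. norm (if n = m then 1 else 0 :: complex))"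
    and dirichlet_monomial: "dirichlet (\<lambda>n. if n = m then 1 else 0) s = of_nat m powr (- s)"
proof -
  show "summable (\<lambda>n. norm (if n = m then 1 else 0 :: complex))"
    by (rule summable_finite[of "{m}"]) auto
  show "dirichlet (\<lambda>n. if n = m then 1 else 0) s = of_nat m powr (- s)"
    unfolding dirichlet_def by (subst suminf_finite[of "{m}"]) auto
qed

lemma Aplus_le_monomial:
  assumes "0 < m" "m \<in> M"
  shows "Aplus_le M (\<lambda>s. of_nat m powr (- s)) 1"
proof -
  let ?a = "\<lambda>n. if n = m then 1 else 0 :: complex"
  have rep: "dser_rep ?a (\<lambda>s. of_nat m powr (- s))"
    using assms summable_monomial[of m] by (simp add: dser_rep_def dirichlet_monomial)
  show ?thesis
  proof (rule Aplus_leI[OF rep])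
    show "(\<Sum>n. norm (?a n)) \<le> 1" by (subst suminf_finite[of "{m}"]) auto
  qed (use assms in \<open>auto split: if_splits\<close>)
qed

lemma Aplus_le_one:
  assumes "1 \<in> M"
  shows "Aplus_le M (\<lambda>_. 1) 1"
  by (rule Aplus_le_cong[OF Aplus_le_monomial[OF _ assms]]) (simp_all add: powr_def)

text \<open>The powers of \<open>g\<close> obey the bounds \<open>r ^ k\<close>, and the exponential
  series is summed in A+. The monoid conditions on \<open>M\<close> keep all powers supported
  there.\<close>

lemma Aplus_le_exp:
  assumes g: "Aplus_le M g r" and one: "1 \<in> M"
    and M: "\<And>x y. x \<in> M \<Longrightarrow> y \<in> M \<Longrightarrow> x * y \<in> M"
  shows "Aplus_le M (\<lambda>s. exp (g s)) (exp r)"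
proof -
  have pow: "Aplus_le M (\<lambda>s. g s ^ k) (r ^ k)" for k
  proof (induction k)
    case 0
    show ?case unfolding power_0 by (rule Aplus_le_one[OF one])
  next
    case (Suc k)
    show ?case unfolding power_Suc by (rule Aplus_le_mult[OF g Suc M])
  qed
  have term_le: "Aplus_le M (\<lambda>s. g s ^ k /\<^sub>R fact k) (r ^ k /\<^sub>R fact k)" for k
    using Aplus_le_cmult[OF pow, of "of_real (inverse (fact k))" k]
    by (simp add: scaleR_conv_of_real norm_inverse)
  show ?thesis
    using Aplus_le_suminf[OF term_le summable_exp_generic] unfolding exp_def .
qed

subsection \<open>Smooth numbers\<close>

text \<open>The index is shifted: \<open>smooth N\<close> is the multiplicative monoid generated by \<open>2, \<dots>, N + 1\<close>.\<close>

primrec smooth :: "nat \<Rightarrow> nat set" where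
  "smooth 0 = {1}"
| "smooth (Suc N) = (\<lambda>(m, e). m * (N + 2) ^ e) ` (smooth N \<times> UNIV)"

lemma smooth_mult: "x \<in> smooth N \<Longrightarrow> y \<in> smooth N \<Longrightarrow> x * y \<in> smooth N"
proof (induction N arbitrary: x y)
  case (Suc N)
  then obtain m e m' e' where "x = m * (N + 2) ^ e" "y = m' * (N + 2) ^ e'"
      and "m \<in> smooth N" "m' \<in> smooth N"
    by auto
  moreover from this have "m * m' \<in> smooth N" by (intro Suc.IH)
  ultimately show ?case
    unfolding smooth.simps by (intro image_eqI[of _ _ "(m * m', e + e')"]) (auto simp: power_add)
qed simp

lemma smooth_Suc_subset: "smooth N \<subseteq> smooth (Suc N)"
proof
  fix x assume "x \<in> smooth N"
  then show "x \<in> smooth (Suc N)"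
    unfolding smooth.simps by (intro image_eqI[of _ _ "(x, 0)"]) auto
qed

lemma one_in_smooth: "1 \<in> smooth N"
  by (induction N) (simp, use smooth_Suc_subset in blast)

lemma le_in_smooth:
  assumes "0 < n" "n \<le> Suc N"
  shows "n \<in> smooth N"
  using assms
proof (induction N)
  case (Suc N)
  show ?case
  proof (cases "n = N + 2")
    case True
    have "(1, 1) \<in> smooth N \<times> UNIV" using one_in_smooth by blast
    then show ?thesis unfolding smooth.simps by (rule rev_image_eqI) (simp add: True)
  next
    case False
    then have "n \<in> smooth N" using Suc by simp
    then show ?thesis using smooth_Suc_subset by blast
  qed
qed auto

text \<open>The map \<open>h\<close> may identify points, so the sum is taken over representatives.
  In the application injectivity can fail because \<open>N + 2\<close> may be composite and
  factorisations in \<open>smooth\<close> are not unique.\<close>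

lemma summable_on_image:
  fixes f :: "'a \<Rightarrow> 'b::banach"
  assumes "(f \<circ> h) summable_on A"
  shows "f summable_on (h ` A)"
proof -
  obtain B where B: "B \<subseteq> A" "inj_on h B" "h ` A = h ` B"
    using subset_image_inj[of "h ` A" h A] by auto
  have "(f \<circ> h) summable_on B"
    by (rule summable_on_subset_banach[OF assms B(1)])
  then show ?thesis using B by (simp add: summable_on_reindex)
qed

text \<open>As in a finite Euler product, adjoining the generator \<open>N + 2\<close> costs at most
  the factor of a geometric series with ratio
  \<open>real (N + 2) powr (- \<epsilon>) < 1\<close>.\<close>

lemma smooth_powr_summable:
  assumes "0 < \<epsilon>"
  shows "(\<lambda>n. real n powr (- \<epsilon>)) summable_on smooth N"
proof (induction N)
  case (Suc N)
  let ?f = "\<lambda>n. real n powr (- \<epsilon>)"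
  let ?q = "?f (N + 2)"
  have q: "0 \<le> ?q" "?q < 1"
    using assms powr_less_mono[of "- \<epsilon>" 0 "real (N + 2)"] by simp_all
  have "(\<lambda>e. ?q ^ e) sums (1 / (1 - ?q))"
    using q by (intro geometric_sums) auto
  then have geo: "((\<lambda>e. ?q ^ e) has_sum (1 / (1 - ?q))) UNIV"
    by (rule sums_nonneg_imp_has_sum) (use q in auto)
  have f_eq: "?f (m * (N + 2) ^ e) = ?f m * ?q ^ e" for m e
  proof -
    have "(b ^ e) powr (- \<epsilon>) = (b powr (- \<epsilon>)) ^ e" if "0 \<le> b" for b :: real
      using that by (induction e) (simp_all add: powr_mult)
    then show ?thesis unfolding of_nat_mult of_nat_power by (simp add: powr_mult)
  qed
  have "(\<lambda>(m, e). ?f m * ?q ^ e) summable_on (smooth N \<times> UNIV)"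
  proof (rule summable_on_SigmaI)
    show "((\<lambda>e. case (m, e) of (m, e) \<Rightarrow> ?f m * ?q ^ e) has_sum (?f m * (1 / (1 - ?q)))) UNIV" for m
      unfolding prod.case by (rule has_sum_cmult_right[OF geo])
    show "(\<lambda>m. ?f m * (1 / (1 - ?q))) summable_on smooth N"
      by (rule summable_on_cmult_left[OF Suc.IH])
  qed (use q in auto)
  then have "(?f \<circ> (\<lambda>(m, e). m * (N + 2) ^ e)) summable_on (smooth N \<times> UNIV)"
    unfolding comp_def case_prod_unfold f_eq .
  then show ?case
    unfolding smooth.simps by (rule summable_on_image)
qed simp

subsection \<open>Boundedness\<close>

text \<open>Gliding hump in the form of Sokal's proof of the uniform boundedness principle: at every step
  one of the two signs of \<open>3\<^sup>-\<^sup>k\<close> times a nearly norming row does not decrease the truncated norm.\<close>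

lemma uniform_boundedness_l1_rows:
  fixes U :: "nat \<Rightarrow> nat \<Rightarrow> complex"
  assumes bd: "\<And>n j. norm (U n j) \<le> 1"
    and sm: "\<And>e n. (\<And>k. norm (e k) \<le> (1/3) ^ k) \<Longrightarrow> summable (\<lambda>j. norm (\<Sum>k. e k * U (n k) j))"
  shows "\<exists>C. \<forall>n J. (\<Sum>j<J. norm (U n j)) \<le> C"
proof (rule ccontr)
  assume neg: "\<not> ?thesis"
  define S where "S n J = (\<Sum>j<J. norm (U n j))" for n J
  have unb: "\<exists>n J. C < S n J" for C
    using neg unfolding S_def by (meson not_le)
  have S_le: "S n J \<le> real J" for n J
    using sum_bounded_above[of "{..<J}" "\<lambda>j. norm (U n j)" 1] bd by (simp add: S_def)
  \<comment> \<open>For fixed \<open>J\<close> the bound \<open>S_le\<close> makes the supremum over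
    the rows finite, so some row exceeds 2/3 of it. The supremum is above \<open>4 ^ k * 2\<close>,
    hence this row is still above \<open>4 ^ k\<close>.\<close>
  have "\<exists>n J. 4 ^ k \<le> S n J \<and> (\<forall>n'. S n' J \<le> 3 / 2 * S n J)" for k :: nat
  proof -
    obtain n0 J where n0: "4 ^ k * 2 < S n0 J" using unb by blast
    let ?L = "SUP n. S n J"
    have bdd: "bdd_above (range (\<lambda>n. S n J))" by (rule bdd_aboveI2[OF S_le])
    have le_L: "S n' J \<le> ?L" for n' by (rule cSUP_upper[OF _ bdd]) simp
    have L: "4 ^ k * 2 < ?L" using n0 le_L[of n0] by linarith
    have "(0::real) < 4 ^ k" by simp
    then have "2 / 3 * ?L < ?L" using L by linarith
    then obtain n where n: "2 / 3 * ?L < S n J"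
      using less_cSUP_iff[OF _ bdd, of "2 / 3 * ?L"] by auto
    have "4 ^ k \<le> S n J" using n L \<open>(0::real) < 4 ^ k\<close> by linarith
    moreover have "S n' J \<le> 3 / 2 * S n J" for n' using le_L[of n'] n by linarith
    ultimately show ?thesis by blast
  qed
  then obtain n J where nJ: "\<And>k. 4 ^ k \<le> S (n k) (J k)" "\<And>k n'. S n' (J k) \<le> 3 / 2 * S (n k) (J k)"
    by metis
  have "\<exists>X. \<forall>k. (k = 0 \<longrightarrow> X k = (\<lambda>_. 0)) \<and>
      (\<exists>\<epsilon>\<in>{1, - 1 :: complex}. X (Suc k) = (\<lambda>j. X k j + \<epsilon> * (1/3) ^ k * U (n k) j) \<and>
         (1/3) ^ k * S (n k) (J k) \<le> (\<Sum>j<J k. norm (X (Suc k) j)))"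
  proof (rule dependent_nat_choice)
    fix x :: "nat \<Rightarrow> complex" and k :: nat
    let ?v = "\<lambda>j. (1/3) ^ k * U (n k) j"
    \<comment> \<open>Writing \<open>2 v\<close> as \<open>(x + v) - (x - v)\<close> shows that the
      truncated norms of \<open>x + v\<close> and \<open>x - v\<close> average to at least that of
      \<open>v\<close>, so one of the signs will do.\<close>
    have "norm (?v j) + norm (?v j) \<le> norm (x j + ?v j) + norm (x j - ?v j)" for j
    proof -
      have "2 * ?v j = (x j + ?v j) - (x j - ?v j)" by simp
      then have "norm (2 * ?v j) \<le> norm (x j + ?v j) + norm (x j - ?v j)"
        by (simp only: norm_triangle_ineq4)
      moreover have "norm (2 * ?v j) = 2 * norm (?v j)" unfolding norm_mult by simp
      ultimately show ?thesis by linarith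
    qed
    then have "(\<Sum>j<J k. norm (?v j) + norm (?v j)) \<le> (\<Sum>j<J k. norm (x j + ?v j) + norm (x j - ?v j))"
      by (intro sum_mono)
    then have "2 * (\<Sum>j<J k. norm (?v j)) \<le> (\<Sum>j<J k. norm (x j + ?v j)) + (\<Sum>j<J k. norm (x j - ?v j))"
      by (simp only: sum.distrib mult_2)
    moreover have "(\<Sum>j<J k. norm (?v j)) = (1/3) ^ k * S (n k) (J k)"
      by (simp add: S_def norm_mult norm_power norm_divide sum_distrib_left)
    ultimately have "(1/3) ^ k * S (n k) (J k) \<le> (\<Sum>j<J k. norm (x j + ?v j)) \<or>
        (1/3) ^ k * S (n k) (J k) \<le> (\<Sum>j<J k. norm (x j - ?v j))"
      by linarith
    then show "\<exists>y. (Suc k = 0 \<longrightarrow> y = (\<lambda>_. 0)) \<and>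
      (\<exists>\<epsilon>\<in>{1, - 1}. y = (\<lambda>j. x j + \<epsilon> * (1/3) ^ k * U (n k) j) \<and>
         (1/3) ^ k * S (n k) (J k) \<le> (\<Sum>j<J k. norm (y j)))"
      by auto
  qed simp
  then obtain X where X0: "X 0 = (\<lambda>_. 0)"
    and X: "\<And>k. \<exists>\<epsilon>\<in>{1, - 1 :: complex}. X (Suc k) = (\<lambda>j. X k j + \<epsilon> * (1/3) ^ k * U (n k) j) \<and>
         (1/3) ^ k * S (n k) (J k) \<le> (\<Sum>j<J k. norm (X (Suc k) j))"
    by blast
  obtain \<epsilon> where \<epsilon>: "\<And>k. \<epsilon> k \<in> {1, - 1 :: complex}"
    and X_Suc: "\<And>k. X (Suc k) = (\<lambda>j. X k j + \<epsilon> k * (1/3) ^ k * U (n k) j)"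
    and X_ge: "\<And>k. (1/3) ^ k * S (n k) (J k) \<le> (\<Sum>j<J k. norm (X (Suc k) j))"
    using X by metis
  define e where "e k = \<epsilon> k * (1/3) ^ k" for k
  have e: "norm (e k) = (1/3) ^ k" for k
    using \<epsilon>[of k] by (auto simp: e_def norm_mult norm_power norm_divide)
  have X_eq: "X k j = (\<Sum>i<k. e i * U (n i) j)" for k j
    by (induction k) (simp_all add: X0 X_Suc e_def)
  define y where "y j = (\<Sum>k. e k * U (n k) j)" for j
  have geo: "summable (\<lambda>i. (1/3) ^ (i + k) :: real)" for k
    by (rule summable_ignore_initial_segment) (simp add: summable_geometric)
  have tail_sum: "(\<Sum>i. (1/3) ^ (i + Suc k)) = 1 / 2 * (1/3 :: real) ^ k" for k
  proof -
    have "(\<Sum>i. (1/3) ^ (i + Suc k)) = (\<Sum>i. (1/3 :: real) ^ i * (1/3) ^ Suc k)"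
      by (simp add: power_add)
    also have "\<dots> = (\<Sum>i. (1/3 :: real) ^ i) * (1/3) ^ Suc k"
      by (rule suminf_mult2[symmetric]) (simp add: summable_geometric)
    also have "\<dots> = 1 / 2 * (1/3) ^ k" by (simp add: suminf_geometric)
    finally show ?thesis .
  qed
  have term_le: "norm (e k * U (n k) j) \<le> (1/3) ^ k" for k j
    using mult_left_mono[OF bd, of "(1/3) ^ k" "n k" j] by (simp add: norm_mult e)
  have smn: "summable (\<lambda>i. norm (e (i + k) * U (n (i + k)) j))" for k j
    by (rule summable_comparison_test'[OF geo[of k], of 0]) (use term_le in simp)
  have y_sm: "summable (\<lambda>j. norm (y j))"
    unfolding y_def by (rule sm) (simp add: e)
  \<comment> \<open>The choices after step \<open>k\<close> lower the truncated norm by at most 1/2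
    times 3/2, that is 3/4, of \<open>(1/3) ^ k * S (n k) (J k)\<close>. A quarter survives and
    grows at least like \<open>(4/3) ^ k\<close>.\<close>
  have main: "1 / 4 * (4 / 3) ^ k \<le> (\<Sum>j. norm (y j))" for k
  proof -
    let ?s = "S (n k) (J k)"
    have diff: "norm (X (Suc k) j) - norm (y j) \<le> (\<Sum>i. norm (e (i + Suc k) * U (n (i + Suc k)) j))" for j
    proof -
      have "summable (\<lambda>i. e i * U (n i) j)"
        using summable_norm_cancel[OF smn[of 0 j]] by simp
      then have "y j - X (Suc k) j = (\<Sum>i. e (i + Suc k) * U (n (i + Suc k)) j)"
        unfolding y_def X_eq by (rule suminf_minus_initial_segment[symmetric])
      then have "norm (y j - X (Suc k) j) \<le> (\<Sum>i. norm (e (i + Suc k) * U (n (i + Suc k)) j))"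
        using summable_norm[OF smn] by (simp only:)
      then show ?thesis using norm_triangle_ineq3[of "X (Suc k) j" "y j"]
        by (simp add: norm_minus_commute)
    qed
    have "(\<Sum>j<J k. norm (X (Suc k) j)) - (\<Sum>j<J k. norm (y j))
        \<le> (\<Sum>j<J k. \<Sum>i. norm (e (i + Suc k) * U (n (i + Suc k)) j))"
      unfolding sum_subtractf[symmetric] by (intro sum_mono diff)
    also have "\<dots> = (\<Sum>i. \<Sum>j<J k. norm (e (i + Suc k) * U (n (i + Suc k)) j))"
      by (rule suminf_sum[symmetric]) (rule smn)
    also have "\<dots> = (\<Sum>i. (1/3) ^ (i + Suc k) * S (n (i + Suc k)) (J k))"
      by (simp only: norm_mult e S_def sum_distrib_left)
    also have "\<dots> \<le> (\<Sum>i. (1/3) ^ (i + Suc k) * (3 / 2 * ?s))"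
    proof (intro suminf_le mult_left_mono nJ summable_mult2 geo)
      show "summable (\<lambda>i. (1/3) ^ (i + Suc k) * S (n (i + Suc k)) (J k))"
        using summable_sum[of "{..<J k}" "\<lambda>j i. norm (e (i + Suc k) * U (n (i + Suc k)) j)"] smn
        by (simp only: norm_mult e S_def sum_distrib_left)
    qed simp
    also have "\<dots> = 1 / 2 * (1/3) ^ k * (3 / 2 * ?s)"
      by (simp only: suminf_mult2[OF geo, symmetric] tail_sum)
    also have "\<dots> = 3 / 4 * ((1/3) ^ k * ?s)" by simp
    finally have "(1/3) ^ k * ?s - 3 / 4 * ((1/3) ^ k * ?s) \<le> (\<Sum>j<J k. norm (y j))"
      using X_ge[of k] by linarith
    also have "\<dots> \<le> (\<Sum>j. norm (y j))" by (rule sum_le_suminf[OF y_sm]) auto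
    finally have "1 / 4 * ((1/3) ^ k * ?s) \<le> (\<Sum>j. norm (y j))" by linarith
    moreover have "(1/3) ^ k * 4 ^ k \<le> (1/3) ^ k * ?s" using nJ(1) by (intro mult_left_mono) auto
    moreover have "(1/3 :: real) ^ k * 4 ^ k = (4 / 3) ^ k"
      by (simp add: power_mult_distrib[symmetric])
    ultimately show ?thesis by linarith
  qed
  obtain k where "4 * (\<Sum>j. norm (y j)) < (4 / 3) ^ k"
    using real_arch_pow[of "4 / 3 :: real"] by auto
  then show False using main[of k] by linarith
qed

section \<open>Boundedness of the operator and of the functions \<open>npow \<phi> n\<close>\<close>

lemma halfplane_image_open_mapping:
  assumes hol: "\<phi> holomorphic_on halfplane 0"
    and nonconst: "\<not> (\<exists>k. \<forall>s\<in>halfplane 0. \<phi> s = k)"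
    and nonneg: "\<phi> ` halfplane 0 \<subseteq> {s. 0 \<le> Re s}"
  shows "\<phi> ` halfplane 0 \<subseteq> halfplane 0"
proof
  have "open (\<phi> ` halfplane 0)"
  proof (rule open_mapping_thm[OF hol])
    show "open (halfplane 0)" unfolding halfplane_def by (rule open_halfspace_Re_gt)
    then show "open (halfplane 0)" .
    show "connected (halfplane 0)"
      unfolding halfplane_def by (intro convex_connected convex_halfspace_Re_gt)
    show "\<not> \<phi> constant_on halfplane 0" using nonconst by (simp add: constant_on_def)
  qed simp
  fix w assume w: "w \<in> \<phi> ` halfplane 0"
  then obtain e where e: "0 < e" "ball w e \<subseteq> \<phi> ` halfplane 0"
    using \<open>open (\<phi> ` halfplane 0)\<close> open_contains_ball by blast
  \<comment> \<open>Moving left by half the radius stays in the open image, where real parts are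
    nonnegative, so \<open>w\<close> itself is off the imaginary axis.\<close>
  have "w - of_real (e / 2) \<in> ball w e" using e(1) by (simp add: dist_norm)
  then have "0 \<le> Re (w - of_real (e / 2))" using e(2) nonneg by blast
  then show "w \<in> halfplane 0" using e(1) by (simp add: halfplane_def)
qed

lemma monomial_in_Aplus:
  assumes "1 \<le> n"
  shows "(\<lambda>s. of_nat n powr (- s)) \<in> Aplus"
  unfolding Aplus_def
proof (intro CollectI exI conjI allI impI)
  let ?a = "\<lambda>k. if k = n then 1 else 0 :: complex"
  show "?a 0 = 0" using assms by simp
  show "summable (\<lambda>k. norm (?a k))" by (rule summable_monomial)
  show "of_nat n powr (- s) = dirichlet ?a s" for s by (rule dirichlet_monomial[symmetric])
qed

lemma AplusE:
  assumes "f \<in> Aplus"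
  obtains a where "dser_rep a f" "\<And>s. 0 \<le> Re s \<Longrightarrow> f s = dirichlet a s"
proof -
  obtain a where a: "a 0 = 0" "summable (\<lambda>n. norm (a n))" "\<And>s. 0 \<le> Re s \<Longrightarrow> f s = dirichlet a s"
    using assms unfolding Aplus_def by blast
  then show thesis by (intro that[of a]) (auto simp: dser_rep_def)
qed

text \<open>\<open>dser_rep\<close> fixes values only on the open half-plane, while
  \<open>Aplus\<close> speaks of the closed one; passing from \<open>f\<close> to the series itself
  bridges the difference.\<close>

lemma dirichlet_in_Aplus:
  assumes "dser_rep a f"
  shows "dirichlet a \<in> Aplus"
  using assms unfolding Aplus_def dser_rep_def by blast

lemma norm_npow: "norm (npow \<phi> n s) = real n powr (- Re (\<phi> s))"
  by (simp add: npow_def norm_of_nat_powr)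

lemma npow_in_Aplus:
  assumes "Cphi_maps_Aplus \<phi>" "1 \<le> n"
  shows "in_Aplus (npow \<phi> n)"
proof -
  have "in_Aplus ((\<lambda>s. of_nat n powr (- s)) \<circ> \<phi>)"
    using assms monomial_in_Aplus unfolding Cphi_maps_Aplus_def by blast
  then show ?thesis by (simp add: npow_def comp_def)
qed

text \<open>The rows given to the gliding hump are the coefficients of
  \<open>npow \<phi> (Suc n)\<close>, with entries at most 1 because the function is. For weights
  \<open>e\<close> the combination of monomials lies in A+, hence so does its image; it remains to
  see that the image has the coefficients \<open>\<Sum>k. e k * U (n k) j\<close>.\<close>

lemma Cphi_maps_imp_npow_bounded:
  assumes maps: "Cphi_maps_Aplus \<phi>" and pos: "\<And>s. 0 < Re s \<Longrightarrow> 0 < Re (\<phi> s)"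
  shows "\<exists>C>0. \<forall>n\<ge>1. Aplus_norm (npow \<phi> n) \<le> C"
proof -
  have "\<exists>U. dser_rep U (npow \<phi> (Suc n))" for n
    using npow_in_Aplus[OF maps, of "Suc n"] by (simp add: in_Aplus_def)
  then obtain U where U: "\<And>n. dser_rep (U n) (npow \<phi> (Suc n))" by metis
  have npow_le: "norm (npow \<phi> n s) \<le> 1" if "0 < Re s" for n s
    using pos[OF that] by (simp add: norm_npow real_nat_powr_le_1)
  have "\<exists>C. \<forall>n J. (\<Sum>j<J. norm (U n j)) \<le> C"
  proof (rule uniform_boundedness_l1_rows)
    show "norm (U n j) \<le> 1" for n j
      by (rule dser_rep_coeff_bound[OF U, of _ _ 0]) (use npow_le in simp)
    fix e :: "nat \<Rightarrow> complex" and n :: "nat \<Rightarrow> nat"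
    assume e: "\<And>k. norm (e k) \<le> (1/3) ^ k"
    have geo: "summable (\<lambda>k. (1/3) ^ k :: real)" by (simp add: summable_geometric)
    have "Aplus_le UNIV (\<lambda>s. e k * of_nat (Suc (n k)) powr (- s)) ((1/3) ^ k)" for k
      by (rule Aplus_le_mono[OF Aplus_le_cmult[OF Aplus_le_monomial]]) (use e in auto)
    then have "Aplus_le UNIV (\<lambda>s. \<Sum>k. e k * of_nat (Suc (n k)) powr (- s)) (\<Sum>k. (1/3) ^ k)"
      by (rule Aplus_le_suminf[OF _ geo])
    then obtain a where a: "dser_rep a (\<lambda>s. \<Sum>k. e k * of_nat (Suc (n k)) powr (- s))"
      unfolding Aplus_le_def by blast
    have "in_Aplus (dirichlet a \<circ> \<phi>)"
      using maps dirichlet_in_Aplus[OF a] unfolding Cphi_maps_Aplus_def by blast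
    then obtain b where b: "dser_rep b (dirichlet a \<circ> \<phi>)" unfolding in_Aplus_def by blast
    have comp_eq: "(dirichlet a \<circ> \<phi>) s = (\<Sum>k. e k * npow \<phi> (Suc (n k)) s)" if "0 < Re s" for s
      using a pos[OF that] by (simp add: dser_rep_def npow_def)
    \<comment> \<open>The image differs from its partial sums by at most a geometric tail uniformly
      in \<open>s\<close>. Each coefficient obeys the same bound, so coefficients converge termwise
      before any norm convergence is known.\<close>
    have "(\<lambda>k. e k * U (n k) j) sums b j" for j
    proof -
      have "norm ((\<Sum>k<K. e k * U (n k) j) - b j) \<le> 3 / 2 * (1/3) ^ K" for K
      proof -
        have rep: "dser_rep (\<lambda>j. b j - (\<Sum>k<K. e k * U (n k) j))
            (\<lambda>s. (dirichlet a \<circ> \<phi>) s - (\<Sum>k<K. e k * npow \<phi> (Suc (n k)) s))"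
          by (intro dser_rep_diff[OF b] dser_rep_sum dser_rep_cmult U)
        have "norm (b j - (\<Sum>k<K. e k * U (n k) j)) \<le> 3 / 2 * (1/3) ^ K"
        proof (rule dser_rep_coeff_bound[OF rep, of _ 0])
          fix s :: complex assume s: "0 < Re s"
          let ?g = "\<lambda>k. e k * npow \<phi> (Suc (n k)) s"
          have term_le: "norm (?g k) \<le> (1/3) ^ k" for k
            using mult_mono[OF e npow_le[OF s], of k] by (simp add: norm_mult)
          have sm: "summable (\<lambda>k. norm (?g (k + K)))" for K
            by (rule summable_comparison_test'[OF summable_ignore_initial_segment[OF geo], of 0])
              (use term_le in simp)
          have "summable ?g" using summable_norm_cancel[OF sm[of 0]] by simp
          then have "(\<Sum>k. ?g k) - (\<Sum>k<K. ?g k) = (\<Sum>k. ?g (k + K))"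
            by (rule suminf_minus_initial_segment[symmetric])
          also have "norm \<dots> \<le> (\<Sum>k. norm (?g (k + K)))" by (rule summable_norm[OF sm])
          also have "\<dots> \<le> (\<Sum>k. (1/3) ^ (k + K))"
            by (intro suminf_le term_le sm summable_ignore_initial_segment[OF geo])
          also have "\<dots> = (\<Sum>k. (1/3) ^ k * (1/3) ^ K)" by (simp only: power_add)
          also have "\<dots> = 3 / 2 * (1/3) ^ K"
            by (simp add: suminf_mult2[OF geo, symmetric] suminf_geometric)
          finally show "norm ((dirichlet a \<circ> \<phi>) s - (\<Sum>k<K. ?g k)) \<le> 3 / 2 * (1/3) ^ K * exp (0 * Re s)"
            using comp_eq[OF s] by simp
        qed
        then show ?thesis by (simp add: norm_minus_commute)
      qed
      moreover have "(\<lambda>K. 3 / 2 * (1/3) ^ K :: real) \<longlonglongrightarrow> 0"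
        by (intro tendsto_mult_right_zero LIMSEQ_power_zero) simp
      ultimately have "(\<lambda>K. (\<Sum>k<K. e k * U (n k) j) - b j) \<longlonglongrightarrow> 0"
        by (rule Lim_null_comparison[OF always_eventually[OF allI]])
      then show ?thesis unfolding sums_def by (rule LIM_zero_cancel)
    qed
    then have "(\<Sum>k. e k * U (n k) j) = b j" for j by (simp add: sums_iff)
    then show "summable (\<lambda>j. norm (\<Sum>k. e k * U (n k) j))"
      using b by (simp add: dser_rep_def)
  qed
  then obtain C where C: "\<And>n J. (\<Sum>j<J. norm (U n j)) \<le> C" by blast
  \<comment> \<open>Rows start at base 1, so row \<open>n - 1\<close> belongs to
    \<open>npow \<phi> n\<close>; the maximum with 1 makes the constant positive.\<close>
  have "Aplus_norm (npow \<phi> n) \<le> max 1 C" if n: "1 \<le> n" for n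
  proof -
    have rep: "dser_rep (U (n - 1)) (npow \<phi> n)" using U[of "n - 1"] n by simp
    have "(\<Sum>j. norm (U (n - 1) j)) \<le> C"
      by (rule suminf_le_const[OF _ C]) (use rep in \<open>simp add: dser_rep_def\<close>)
    then show ?thesis by (simp add: Aplus_norm_eq[OF rep])
  qed
  then show ?thesis by (intro exI[of _ "max 1 C"]) auto
qed

text \<open>The composition is the series of the functions \<open>a n * npow \<phi> n\<close>.
  Boundedness uses a constant \<open>r\<close>; compactness uses weights \<open>r n\<close> that
  tend to 0.\<close>

lemma Aplus_le_compose:
  assumes "a 0 = 0" "\<And>n. 1 \<le> n \<Longrightarrow> Aplus_le UNIV (npow \<phi> n) (r n)"
    and "summable (\<lambda>n. norm (a n) * r n)"
  shows "Aplus_le UNIV (\<lambda>s. dirichlet a (\<phi> s)) (\<Sum>n. norm (a n) * r n)"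
proof -
  have "Aplus_le UNIV (\<lambda>s. a n * npow \<phi> n s) (norm (a n) * r n)" for n
  proof (cases "n = 0")
    case True
    then show ?thesis using assms(1) by (simp add: Aplus_le_zero)
  next
    case False
    then show ?thesis using assms(2)[of n] by (intro Aplus_le_cmult) simp
  qed
  from Aplus_le_suminf[OF this assms(3)] show ?thesis
    by (simp add: dirichlet_def npow_def)
qed

lemma npow_bounded_imp_nonneg:
  assumes "\<And>n. 1 \<le> n \<Longrightarrow> Aplus_le UNIV (npow \<phi> n) B" "0 < Re s"
  shows "0 \<le> Re (\<phi> s)"
proof (rule ccontr)
  assume neg: "\<not> 0 \<le> Re (\<phi> s)"
  define c where "c = - Re (\<phi> s)"
  have c: "0 < c" using neg by (simp add: c_def)
  \<comment> \<open>Chosen so that \<open>x powr c = \<bar>B\<bar> + 1\<close>: for \<open>n\<close>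
    beyond \<open>x\<close> the modulus \<open>real n powr c\<close> of
    \<open>npow \<phi> n s\<close> exceeds \<open>B\<close>.\<close>
  define x where "x = (\<bar>B\<bar> + 1) powr (1 / c)"
  obtain n :: nat where n: "max 1 x < real n" using reals_Archimedean2 by blast
  have "\<bar>B\<bar> + 1 = x powr c" using c by (simp add: x_def powr_powr)
  also have "\<dots> \<le> real n powr c" using n c by (intro powr_mono2) (auto simp: x_def)
  also have "\<dots> = norm (npow \<phi> n s)" by (simp add: norm_npow c_def)
  also have "\<dots> \<le> B" using n by (intro Aplus_le_bound[OF assms]) simp
  finally show False by simp
qed

lemma npow_bounded_imp_maps:
  assumes B: "\<And>n. 1 \<le> n \<Longrightarrow> Aplus_le UNIV (npow \<phi> n) B" and f: "f \<in> Aplus"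
  shows "Aplus_le UNIV (f \<circ> \<phi>) (B * Aplus_norm f)"
proof -
  obtain a where a: "dser_rep a f" "\<And>s. 0 \<le> Re s \<Longrightarrow> f s = dirichlet a s"
    using AplusE[OF f] by metis
  have sm: "summable (\<lambda>n. norm (a n))" using a(1) by (simp add: dser_rep_def)
  have "Aplus_le UNIV (\<lambda>s. dirichlet a (\<phi> s)) (\<Sum>n. norm (a n) * B)"
    by (rule Aplus_le_compose[OF _ B summable_mult2[OF sm]]) (use a in \<open>auto simp: dser_rep_def\<close>)
  then have "Aplus_le UNIV (f \<circ> \<phi>) (\<Sum>n. norm (a n) * B)"
    by (rule Aplus_le_cong) (use a(2) npow_bounded_imp_nonneg[OF B] in simp)
  then show ?thesis
    by (simp only: Aplus_norm_eq[OF a(1)] suminf_mult2[OF sm, symmetric] mult.commute[of B])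
qed

lemma npow_bounded_imp_Cphi_bounded:
  assumes B: "\<And>n. 1 \<le> n \<Longrightarrow> Aplus_le UNIV (npow \<phi> n) B"
  shows "Cphi_bounded \<phi>"
  unfolding Cphi_bounded_def Cphi_maps_Aplus_def
proof (intro conjI ballI exI)
  show "\<phi> ` halfplane 0 \<subseteq> {s. 0 \<le> Re s}"
    using npow_bounded_imp_nonneg[OF B] by (auto simp: halfplane_def)
  fix f assume "f \<in> Aplus"
  note le = npow_bounded_imp_maps[OF B this]
  show "in_Aplus (f \<circ> \<phi>)" by (rule Aplus_le_imp_in_Aplus[OF le])
  show "Aplus_norm (f \<circ> \<phi>) \<le> B * Aplus_norm f" by (rule Aplus_le_imp_norm_le[OF le])
qed

subsection \<open>Compactness\<close>

text \<open>Split the sum where \<open>R\<close> drops below \<open>\<eta>\<close>: the head is a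
  finite sum of null sequences, the tail is at most \<open>B * \<eta>\<close>.\<close>

lemma weighted_l1_tendsto_0:
  fixes d :: "nat \<Rightarrow> nat \<Rightarrow> real" and R :: "nat \<Rightarrow> real"
  assumes d: "\<And>k n. 0 \<le> d k n" "\<And>k. summable (d k)" "\<And>k. (\<Sum>n. d k n) \<le> B"
    and lim: "\<And>n. (\<lambda>k. d k n) \<longlonglongrightarrow> 0"
    and R: "\<And>n. 0 \<le> R n" "R \<longlonglongrightarrow> 0"
  shows "\<And>k. summable (\<lambda>n. d k n * R n)" and "(\<lambda>k. \<Sum>n. d k n * R n) \<longlonglongrightarrow> 0"
proof -
  obtain C where C: "\<And>n. R n \<le> C"
    using convergent_imp_Bseq[OF convergentI[OF R(2)]] R(1)
    by (metis (no_types, opaque_lifting) BseqE abs_of_nonneg real_norm_def)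
  show sm: "summable (\<lambda>n. d k n * R n)" for k
    by (rule summable_comparison_test'[OF summable_mult2[OF d(2), of k C], of 0])
      (use d(1) R(1) C in \<open>auto simp: abs_mult intro: mult_left_mono\<close>)
  show "(\<lambda>k. \<Sum>n. d k n * R n) \<longlonglongrightarrow> 0"
  proof (rule LIMSEQ_I)
    fix e :: real assume e: "0 < e"
    have B: "0 \<le> B" using d(3)[of 0] suminf_nonneg[OF d(2) d(1), of 0] by linarith
    \<comment> \<open>Dividing by \<open>B + 1\<close> covers \<open>B = 0\<close> and still gives
      \<open>B * \<eta> \<le> e / 2\<close>.\<close>
    define \<eta> where "\<eta> = e / (2 * (B + 1))"
    have \<eta>: "0 < \<eta>" using e B by (simp add: \<eta>_def)
    obtain N where N: "\<And>n. N \<le> n \<Longrightarrow> R n < \<eta>"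
      using order_tendstoD(2)[OF R(2) \<eta>] unfolding eventually_sequentially by blast
    have "(\<lambda>k. \<Sum>n<N. d k n * R n) \<longlonglongrightarrow> (\<Sum>n<N. 0 * R n)"
      by (intro tendsto_intros lim)
    then have "\<forall>\<^sub>F k in sequentially. (\<Sum>n<N. d k n * R n) < e / 2"
      by (rule order_tendstoD(2)) (use e in simp)
    then obtain K where K: "\<And>k. K \<le> k \<Longrightarrow> (\<Sum>n<N. d k n * R n) < e / 2"
      unfolding eventually_sequentially by blast
    have "norm ((\<Sum>n. d k n * R n) - 0) < e" if k: "K \<le> k" for k
    proof -
      have "(\<Sum>n. d k n * R n) = (\<Sum>n. d k (n + N) * R (n + N)) + (\<Sum>n<N. d k n * R n)"
        by (rule suminf_split_initial_segment[OF sm])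
      also have "(\<Sum>n. d k (n + N) * R (n + N)) \<le> (\<Sum>n. d k (n + N) * \<eta>)"
        using summable_ignore_initial_segment[OF sm, of k N]
          summable_mult2[OF summable_ignore_initial_segment[OF d(2)[of k], of N], of \<eta>]
        by (intro suminf_le mult_left_mono less_imp_le[OF N] d) auto
      also have "\<dots> = (\<Sum>n. d k (n + N)) * \<eta>"
        by (rule suminf_mult2[OF summable_ignore_initial_segment[OF d(2)], symmetric])
      also have "\<dots> \<le> B * \<eta>"
      proof (rule mult_right_mono)
        have "(\<Sum>n. d k (n + N)) = (\<Sum>n. d k n) - (\<Sum>n<N. d k n)"
          by (rule suminf_minus_initial_segment[OF d(2)])
        moreover have "0 \<le> (\<Sum>n<N. d k n)" by (intro sum_nonneg d)
        ultimately show "(\<Sum>n. d k (n + N)) \<le> B" using d(3)[of k] by linarith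
      qed (use \<eta> in simp)
      also have "\<dots> \<le> e / 2" using B e by (simp add: \<eta>_def field_simps)
      finally have "(\<Sum>n. d k n * R n) < e" using K[OF k] by linarith
      moreover have "0 \<le> (\<Sum>n. d k n * R n)" by (intro suminf_nonneg sm mult_nonneg_nonneg d R)
      ultimately show ?thesis by simp
    qed
    then show "\<exists>K. \<forall>k\<ge>K. norm ((\<Sum>n. d k n * R n) - 0) < e" by blast
  qed
qed

lemma Aplus_norm_nonneg: "in_Aplus g \<Longrightarrow> 0 \<le> Aplus_norm g"
  by (rule Aplus_le_nonneg[OF Aplus_le_norm])

lemma dirichlet_diff:
  assumes "summable (\<lambda>n. norm (a n))" "summable (\<lambda>n. norm (b n))" "0 \<le> Re s"
  shows "dirichlet (\<lambda>n. a n - b n) s = dirichlet a s - dirichlet b s"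
  using sums_diff[OF dirichlet_sums[OF assms(1,3)] dirichlet_sums[OF assms(2,3)]]
  by (simp add: dirichlet_def sums_iff left_diff_distrib)

lemma npow_tendsto_0_imp_compact:
  assumes inA: "\<And>n. 1 \<le> n \<Longrightarrow> in_Aplus (npow \<phi> n)"
    and lim: "(\<lambda>n. Aplus_norm (npow \<phi> n)) \<longlonglongrightarrow> 0"
  shows "Cphi_compact \<phi>"
proof -
  obtain B where B: "\<And>n. norm (Aplus_norm (npow \<phi> n)) \<le> B"
    using convergent_imp_Bseq[OF convergentI[OF lim]] by (metis BseqE)
  have le_B: "Aplus_le UNIV (npow \<phi> n) B" if "1 \<le> n" for n
    using B[of n] by (intro Aplus_le_mono[OF Aplus_le_norm[OF inA[OF that]]]) auto
  have maps: "Cphi_maps_Aplus \<phi>"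
    using npow_bounded_imp_Cphi_bounded[OF le_B] by (simp add: Cphi_bounded_def)
  have nonneg: "0 \<le> Re (\<phi> s)" if "0 < Re s" for s
    using npow_bounded_imp_nonneg[OF le_B that] .
  \<comment> \<open>\<open>npow \<phi> 0\<close> is the zero function because
    \<open>0 powr z = 0\<close>, so the weights \<open>R\<close> are nonnegative from index 0
    on.\<close>
  have inA0: "in_Aplus (npow \<phi> n)" for n
  proof (cases "n = 0")
    case True
    then have "npow \<phi> n = (\<lambda>_. 0)" by (simp add: npow_def)
    then show ?thesis using dser_rep_zero by (auto simp: in_Aplus_def)
  qed (use inA in simp)
  define R where "R n = Aplus_norm (npow \<phi> n)" for n
  have R: "0 \<le> R n" "R n \<le> B" for n
    using Aplus_norm_nonneg[OF inA0] B[of n] by (auto simp: R_def)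
  have "\<exists>r g. strict_mono r \<and> in_Aplus g \<and> (\<lambda>k. Aplus_norm (\<lambda>s. F (r k) (\<phi> s) - g s)) \<longlonglongrightarrow> 0"
    if F: "\<And>k. F k \<in> Aplus" "\<And>k. Aplus_norm (F k) \<le> 1" for F :: "nat \<Rightarrow> complex \<Rightarrow> complex"
  proof -
    have "\<exists>a. dser_rep a (F k) \<and> (\<forall>s. 0 \<le> Re s \<longrightarrow> F k s = dirichlet a s)" for k
      using AplusE[OF F(1)] by metis
    then obtain a where a: "\<And>k. dser_rep (a k) (F k)"
        "\<And>k s. 0 \<le> Re s \<Longrightarrow> F k s = dirichlet (a k) s"
      by metis
    have sm: "summable (\<lambda>n. norm (a k n))" and a0: "a k 0 = 0" for k
      using a(1)[of k] by (auto simp: dser_rep_def)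
    have le1: "(\<Sum>n. norm (a k n)) \<le> 1" for k
      using F(2)[of k] by (simp add: Aplus_norm_eq[OF a(1)])
    have part_le1: "sum (\<lambda>n. norm (a k n)) A \<le> 1" if "finite A" for k A
      by (rule order_trans[OF sum_le_suminf[OF sm that] le1]) simp
    \<comment> \<open>The coefficients are bounded by 1, so a diagonal subsequence converges at
      every index. Passing to the limit in finite partial sums then puts \<open>l\<close> in the
      unit ball of absolutely summable sequences.\<close>
    obtain r where r: "strict_mono r" "\<And>n. \<exists>l. (\<lambda>k. a (r k) n) \<longlonglongrightarrow> l"
      using function_convergent_subsequence[of "UNIV :: nat set" a 1] part_le1[of "{n}" for n]
      by auto
    obtain l where l: "\<And>n. (\<lambda>k. a (r k) n) \<longlonglongrightarrow> l n" using r(2) by metis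
    have l_part: "(\<Sum>n<N. norm (l n)) \<le> 1" for N
    proof (rule tendsto_upperbound)
      show "(\<lambda>k. \<Sum>n<N. norm (a (r k) n)) \<longlonglongrightarrow> (\<Sum>n<N. norm (l n))"
        by (intro tendsto_intros l)
    qed (use part_le1 in auto)
    have sml: "summable (\<lambda>n. norm (l n))"
      by (rule summableI_nonneg_bounded[OF _ l_part]) simp
    have l_le1: "(\<Sum>n. norm (l n)) \<le> 1" by (rule suminf_le_const[OF sml l_part])
    have l0: "l 0 = 0" using l[of 0] a0 by (simp add: LIMSEQ_const_iff)
    define g where "g s = dirichlet l (\<phi> s)" for s
    have "summable (\<lambda>n. norm (l n) * R n)"
      by (rule summable_comparison_test'[OF summable_mult2[OF sml], of 0 _ B])
        (use R in \<open>auto simp: abs_mult intro: mult_left_mono\<close>)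
    then have "Aplus_le UNIV g (\<Sum>n. norm (l n) * R n)"
      unfolding g_def[abs_def] R_def by (intro Aplus_le_compose l0 Aplus_le_norm inA)
    then have g: "in_Aplus g" by (rule Aplus_le_imp_in_Aplus)
    define d where "d k n = norm (a (r k) n - l n)" for k n
    have d_le: "d k n \<le> norm (a (r k) n) + norm (l n)" for k n
      by (simp add: d_def norm_triangle_ineq4)
    have d_sm: "summable (d k)" for k
      by (rule summable_comparison_test'[OF summable_add[OF sm sml], of 0])
        (use d_le in \<open>simp add: d_def\<close>)
    have d_le2: "(\<Sum>n. d k n) \<le> 2" for k
    proof -
      have "(\<Sum>n. d k n) \<le> (\<Sum>n. norm (a (r k) n) + norm (l n))"
        by (intro suminf_le d_le d_sm summable_add sm sml)
      also have "\<dots> = (\<Sum>n. norm (a (r k) n)) + (\<Sum>n. norm (l n))"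
        by (rule suminf_add[OF sm sml, symmetric])
      finally show ?thesis using le1[of "r k"] l_le1 by linarith
    qed
    have d_lim: "(\<lambda>k. d k n) \<longlonglongrightarrow> 0" for n
      unfolding d_def using l[of n] by (intro tendsto_norm_zero) (simp add: LIM_zero_iff)
    have R_lim: "R \<longlonglongrightarrow> 0" using lim by (simp add: R_def[abs_def])
    have d_nonneg: "0 \<le> d k n" for k n by (simp add: d_def)
    \<comment> \<open>The differences \<open>d k\<close> are only bounded in sum and null at each
      index; the weights \<open>R n\<close>, which tend to 0, turn this into norm convergence of the
      images.\<close>
    note w = weighted_l1_tendsto_0[of d 2 R, OF d_nonneg d_sm d_le2 d_lim R(1) R_lim]
    have le: "Aplus_le UNIV (\<lambda>s. F (r k) (\<phi> s) - g s) (\<Sum>n. d k n * R n)" for k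
    proof (rule Aplus_le_cong)
      show "Aplus_le UNIV (\<lambda>s. dirichlet (\<lambda>n. a (r k) n - l n) (\<phi> s)) (\<Sum>n. d k n * R n)"
        using w(1)[of k] unfolding d_def R_def
        by (intro Aplus_le_compose Aplus_le_norm inA) (simp_all add: a0 l0)
      show "dirichlet (\<lambda>n. a (r k) n - l n) (\<phi> s) = F (r k) (\<phi> s) - g s" if "0 < Re s" for s
        using nonneg[OF that] by (simp add: dirichlet_diff sm sml a(2) g_def)
    qed
    have "norm (Aplus_norm (\<lambda>s. F (r k) (\<phi> s) - g s)) \<le> (\<Sum>n. d k n * R n)" for k
      using Aplus_norm_nonneg[OF Aplus_le_imp_in_Aplus[OF le[of k]]] Aplus_le_imp_norm_le[OF le[of k]]
      by simp
    then have "(\<lambda>k. Aplus_norm (\<lambda>s. F (r k) (\<phi> s) - g s)) \<longlonglongrightarrow> 0"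
      by (intro Lim_null_comparison[OF _ w(2)]) simp
    then show ?thesis using r(1) g by blast
  qed
  then show ?thesis using maps unfolding Cphi_compact_def by blast
qed

lemma Aplus_norm_cong:
  assumes "\<And>s. 0 < Re s \<Longrightarrow> f s = g s"
  shows "Aplus_norm f = Aplus_norm g"
  using assms by (simp add: Aplus_norm_def dser_rep_def)

text \<open>Indices with norm at least \<open>e\<close> supply monomials in the unit ball. Along a
  subsequence their images converge in norm, hence pointwise; strict positivity of
  \<open>Re (\<phi> s)\<close> makes the limit 0, against the lower bound \<open>e\<close>.\<close>

lemma compact_imp_npow_tendsto_0:
  assumes cpt: "Cphi_compact \<phi>" and pos: "\<And>s. 0 < Re s \<Longrightarrow> 0 < Re (\<phi> s)"
  shows "(\<lambda>n. Aplus_norm (npow \<phi> n)) \<longlonglongrightarrow> 0"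
proof (rule ccontr)
  assume "\<not> ?thesis"
  then obtain e where e: "0 < e" "\<And>N. \<exists>n\<ge>N. e \<le> \<bar>Aplus_norm (npow \<phi> n)\<bar>"
    unfolding LIMSEQ_iff by (auto simp: not_less)
  have maps: "Cphi_maps_Aplus \<phi>" using cpt by (simp add: Cphi_compact_def)
  note inA = npow_in_Aplus[OF maps]
  define S where "S = {n. 1 \<le> n \<and> e \<le> Aplus_norm (npow \<phi> n)}"
  have "infinite S"
    unfolding infinite_nat_iff_unbounded_le
  proof
    fix N
    obtain n where n: "max 1 N \<le> n" "e \<le> \<bar>Aplus_norm (npow \<phi> n)\<bar>" using e(2) by blast
    then show "\<exists>n\<ge>N. n \<in> S" using Aplus_norm_nonneg[OF inA[of n]] by (auto simp: S_def)
  qed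
  define m where "m = enumerate S"
  have m: "strict_mono m" "m k \<in> S" for k
    using \<open>infinite S\<close> by (auto simp: m_def strict_mono_enumerate enumerate_in_set)
  have m1: "1 \<le> m k" for k using m(2)[of k] by (simp add: S_def)
  define F where "F k s = (of_nat (m k) :: complex) powr (- s)" for k s
  have "F k \<in> Aplus" for k
    unfolding F_def[abs_def] by (rule monomial_in_Aplus[OF m1])
  moreover have "Aplus_norm (F k) \<le> 1" for k
    unfolding F_def[abs_def] using m1[of k]
    by (intro Aplus_le_imp_norm_le[OF Aplus_le_monomial[of _ UNIV]]) auto
  ultimately obtain r g where r: "strict_mono r" "in_Aplus g"
      and lim: "(\<lambda>k. Aplus_norm (\<lambda>s. F (r k) (\<phi> s) - g s)) \<longlonglongrightarrow> 0"
    using cpt unfolding Cphi_compact_def by blast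
  have F_eq: "F k (\<phi> s) = npow \<phi> (m k) s" for k s by (simp add: F_def npow_def)
  have g0: "g s = 0" if s: "0 < Re s" for s
  proof -
    have "norm (npow \<phi> (m (r k)) s - g s) \<le> Aplus_norm (\<lambda>s. F (r k) (\<phi> s) - g s)" for k
    proof -
      have "in_Aplus (\<lambda>s. npow \<phi> (m (r k)) s - g s)"
        using inA[OF m1] r(2) dser_rep_diff unfolding in_Aplus_def by blast
      from Aplus_le_bound[OF Aplus_le_norm[OF this] s] show ?thesis by (simp add: F_eq)
    qed
    then have "(\<lambda>k. npow \<phi> (m (r k)) s - g s) \<longlonglongrightarrow> 0"
      by (intro Lim_null_comparison[OF _ lim]) simp
    then have 1: "(\<lambda>k. npow \<phi> (m (r k)) s) \<longlonglongrightarrow> g s" by (rule LIM_zero_cancel)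
    have "filterlim (\<lambda>k. m (r k)) at_top sequentially"
      using filterlim_subseq[OF strict_mono_o[OF m(1) r(1)]] by (simp add: comp_def)
    then have "filterlim (\<lambda>k. real (m (r k))) at_top sequentially"
      by (rule filterlim_compose[OF filterlim_real_sequentially])
    then have "(\<lambda>k. real (m (r k)) powr (- Re (\<phi> s))) \<longlonglongrightarrow> 0"
      using pos[OF s] by (intro tendsto_neg_powr) simp_all
    then have "(\<lambda>k. npow \<phi> (m (r k)) s) \<longlonglongrightarrow> 0"
      by (simp only: norm_npow[symmetric] tendsto_norm_zero_iff)
    then show ?thesis by (rule LIMSEQ_unique[OF 1])
  qed
  have "Aplus_norm (\<lambda>s. F (r k) (\<phi> s) - g s) = Aplus_norm (npow \<phi> (m (r k)))" for k
    by (rule Aplus_norm_cong) (simp add: F_eq g0)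
  then have "e \<le> Aplus_norm (\<lambda>s. F (r k) (\<phi> s) - g s)" for k
    using m(2)[of "r k"] by (simp add: S_def)
  then have "e \<le> 0" by (intro tendsto_lowerbound[OF lim]) auto
  then show False using e(1) by simp
qed

text \<open>A single index suffices: a norm below 1/2 gives
  \<open>real n powr (- Re (\<phi> s)) < 1 / 2\<close> for all \<open>s\<close>, hence a uniform
  lower bound for \<open>Re (\<phi> s)\<close>. Taking \<open>n\<close> at least 2 makes
  \<open>ln (real n)\<close> positive.\<close>

lemma npow_tendsto_0_imp_halfplane:
  assumes inA: "\<And>n. 1 \<le> n \<Longrightarrow> in_Aplus (npow \<phi> n)"
    and lim: "(\<lambda>n. Aplus_norm (npow \<phi> n)) \<longlonglongrightarrow> 0"
  shows "\<exists>\<delta>>0. \<phi> ` halfplane 0 \<subseteq> halfplane \<delta>"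
proof -
  have "\<forall>\<^sub>F n in sequentially. Aplus_norm (npow \<phi> n) < 1 / 2"
    by (rule order_tendstoD(2)[OF lim]) simp
  then obtain N where N: "\<And>n. N \<le> n \<Longrightarrow> Aplus_norm (npow \<phi> n) < 1 / 2"
    unfolding eventually_sequentially by blast
  define n where "n = max N 2"
  have n: "2 \<le> n" "Aplus_norm (npow \<phi> n) < 1 / 2" using N[of n] by (auto simp: n_def)
  have ln_pos: "0 < ln (real n)" using n(1) by simp
  define \<delta> where "\<delta> = ln 2 / ln (real n) / 2"
  have "\<delta> < Re (\<phi> s)" if s: "0 < Re s" for s
  proof -
    have "real n powr (- Re (\<phi> s)) \<le> Aplus_norm (npow \<phi> n)"
      using Aplus_le_bound[OF Aplus_le_norm[OF inA] s, of n] n(1) by (simp add: norm_npow)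
    then have "real n powr (- Re (\<phi> s)) < 1 / 2" using n(2) by linarith
    then have "exp (- Re (\<phi> s) * ln (real n)) < exp (- ln 2)"
      using n(1) by (simp add: powr_def exp_minus)
    then have "ln 2 < Re (\<phi> s) * ln (real n)" by simp
    then have "ln 2 / ln (real n) < Re (\<phi> s)" using ln_pos by (simp add: field_simps)
    moreover have "\<delta> < ln 2 / ln (real n)" using ln_pos by (simp add: \<delta>_def divide_strict_left_mono)
    ultimately show ?thesis by linarith
  qed
  moreover have "0 < \<delta>" using ln_pos by (simp add: \<delta>_def)
  ultimately show ?thesis by (auto simp: halfplane_def)
qed

subsection \<open>Exponential decay\<close>

lemma dirichlet_translate:
  "dirichlet (\<lambda>n. a n * of_real (real n powr x)) s = dirichlet a (s - of_real x)"
proof -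
  have "(of_nat n :: complex) powr (- (s - of_real x)) = of_real (real n powr x) * of_nat n powr (- s)" for n
  proof -
    have "(of_nat n :: complex) powr (- (s - of_real x)) = of_nat n powr (of_real x) * of_nat n powr (- s)"
      by (simp add: powr_add[symmetric])
    also have "(of_nat n :: complex) powr (of_real x) = of_real (real n powr x)"
      using powr_of_real[of "real n" x] by simp
    finally show ?thesis .
  qed
  then show ?thesis by (simp add: dirichlet_def mult.assoc)
qed

lemma Aplus_le_dirichlet:
  assumes "a 0 = 0" "summable (\<lambda>n. norm (a n))" "\<And>n. a n \<noteq> 0 \<Longrightarrow> n \<in> M"
  shows "Aplus_le M (dirichlet a) (\<Sum>n. norm (a n))"
  by (rule Aplus_leI[of a]) (use assms in \<open>auto simp: dser_rep_def\<close>)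

text \<open>Translation multiplies the coefficient at \<open>n\<close> by
  \<open>real n powr (- \<epsilon>)\<close>, which is summable over \<open>M\<close>; a uniform
  bound on coefficients thus becomes a norm bound.\<close>

lemma Aplus_le_translate:
  assumes rep: "dser_rep b g" and supp: "\<And>n. b n \<noteq> 0 \<Longrightarrow> n \<in> M" and K: "\<And>n. norm (b n) \<le> K"
    and M: "(\<lambda>n. real n powr (- \<epsilon>)) summable_on M" and \<epsilon>: "0 < \<epsilon>"
  shows "Aplus_le M (\<lambda>s. g (s + of_real \<epsilon>)) (K * (\<Sum>n. if n \<in> M then real n powr (- \<epsilon>) else 0))"
proof -
  let ?z = "\<lambda>n. if n \<in> M then real n powr (- \<epsilon>) else 0"
  have "?z summable_on UNIV"
    using M by (rule summable_on_cong_neutral[THEN iffD1, rotated -1]) auto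
  then have smz: "summable ?z" by (rule summable_on_imp_summable)
  define d where "d n = b n * of_real (real n powr (- \<epsilon>))" for n
  have d_le: "norm (d n) \<le> K * ?z n" for n
    using supp[of n] K[of n] by (cases "b n = 0") (auto simp: d_def norm_mult mult_right_mono)
  have smd: "summable (\<lambda>n. norm (d n))"
    by (rule summable_comparison_test'[OF summable_mult[OF smz, of K], of 0]) (use d_le in simp)
  have "dser_rep d (\<lambda>s. g (s + of_real \<epsilon>))"
    unfolding dser_rep_def
  proof (intro conjI allI impI smd)
    show "d 0 = 0" by (simp add: d_def)
    fix s :: complex assume "0 < Re s"
    then have "g (s + of_real \<epsilon>) = dirichlet b (s + of_real \<epsilon>)"
      using rep \<epsilon> by (simp add: dser_rep_def)
    then show "g (s + of_real \<epsilon>) = dirichlet d s"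
      by (simp add: d_def[abs_def] dirichlet_translate)
  qed
  moreover have "n \<in> M" if "d n \<noteq> 0" for n using that supp by (auto simp: d_def)
  moreover have "(\<Sum>n. norm (d n)) \<le> K * (\<Sum>n. ?z n)"
    unfolding suminf_mult[OF smz, symmetric] by (intro suminf_le d_le smd summable_mult smz)
  ultimately show ?thesis by (rule Aplus_leI)
qed

text \<open>After truncating the series to \<open>n \<le> N\<close>, moving the abscissa slightly to the left of 0 costs only
  a small loss in the lower bound of the real part. The coefficients of the exponential then decay
  like \<open>n\<^bsup>-\<epsilon>\<^esup>\<close>, which is summable over the smooth numbers supporting them.\<close>

lemma exp_dirichlet_decay:
  fixes c :: "nat \<Rightarrow> complex"
  assumes c0: "c 0 = 0" and sm: "summable (\<lambda>n. norm (c n))"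
    and \<kappa>: "\<And>s. 0 < Re s \<Longrightarrow> \<delta> - \<kappa> * Re s \<le> Re (dirichlet c s)" and \<gamma>: "\<gamma> < \<delta>"
  shows "\<exists>Z. \<forall>t\<ge>0. Aplus_le UNIV (\<lambda>s. exp (- of_real t * dirichlet c s)) (Z * exp (- t * \<gamma>))"
proof -
  \<comment> \<open>The gap \<open>\<delta> - \<gamma>\<close> pays for three losses: dropping the
    tail \<open>q\<close> from the real part, moving the abscissa, and multiplying the exponential
    of the tail back in.\<close>
  define \<eta> where "\<eta> = (\<delta> - \<gamma>) / 3"
  have \<eta>: "0 < \<eta>" using \<gamma> by (simp add: \<eta>_def)
  obtain N0 where "\<And>n. N0 \<le> n \<Longrightarrow> norm (\<Sum>i. norm (c (i + n))) < \<eta>"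
    using suminf_exist_split[OF \<eta> sm] by blast
  then obtain N where N: "(\<Sum>i. norm (c (i + Suc N))) < \<eta>"
    using le_SucI[OF order_refl, of N0] by (metis abs_ge_self order_le_less_trans real_norm_def)
  define p where "p n = (if n \<le> N then c n else 0)" for n
  define q where "q n = (if n \<le> N then 0 else c n)" for n
  have smq: "summable (\<lambda>n. norm (q n))"
    by (rule summable_comparison_test'[OF sm, of 0]) (simp add: q_def)
  have smp: "summable (\<lambda>n. norm (p n))"
    by (rule summable_finite[of "{..N}"]) (auto simp: p_def)
  have q_sum: "(\<Sum>n. norm (q n)) < \<eta>"
  proof -
    have "(\<Sum>n. norm (q n)) = (\<Sum>n. norm (q (n + Suc N))) + (\<Sum>n<Suc N. norm (q n))"
      by (rule suminf_split_initial_segment[OF smq])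
    also have "(\<Sum>n<Suc N. norm (q n)) = 0" by (rule sum.neutral) (auto simp: q_def)
    also have "(\<Sum>n. norm (q (n + Suc N))) = (\<Sum>n. norm (c (n + Suc N)))"
      by (simp add: q_def)
    finally show ?thesis using N by simp
  qed
  \<comment> \<open>Only finitely many \<open>n\<close> occur and \<open>real n powr x\<close> tends
    to 1, so some \<open>\<epsilon> > 0\<close> changes the coefficients by less than
    \<open>\<eta>\<close> in total.\<close>
  have "((\<lambda>x. \<Sum>n\<in>{1..N}. norm (c n) * \<bar>real n powr x - 1\<bar>) \<longlongrightarrow>
      (\<Sum>n\<in>{1..N}. norm (c n) * \<bar>real n powr 0 - 1\<bar>)) (at_right 0)"
    by (intro tendsto_intros) auto
  then have "\<forall>\<^sub>F x in at_right 0. (\<Sum>n\<in>{1..N}. norm (c n) * \<bar>real n powr x - 1\<bar>) < \<eta>"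
    by (rule order_tendstoD(2)) (use \<eta> in simp)
  then have "\<forall>\<^sub>F x in at_right 0. 0 < x \<and> (\<Sum>n\<in>{1..N}. norm (c n) * \<bar>real n powr x - 1\<bar>) < \<eta>"
    using eventually_at_right_less[of "0::real"] by eventually_elim simp
  then obtain \<epsilon> where \<epsilon>: "0 < \<epsilon>" "(\<Sum>n\<in>{1..N}. norm (c n) * \<bar>real n powr \<epsilon> - 1\<bar>) < \<eta>"
    using eventually_happens'[OF trivial_limit_at_right_real] by blast
  \<comment> \<open>The value of \<open>dirichlet p'\<close> at \<open>s + \<epsilon>\<close> is
    that of \<open>dirichlet p\<close> at \<open>s\<close>, so an estimate for \<open>p'\<close>
    returns to \<open>p\<close> by translation.\<close>
  define p' where "p' n = p n * of_real (real n powr \<epsilon>)" for n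
  have smp': "summable (\<lambda>n. norm (p' n))"
    by (rule summable_finite[of "{..N}"]) (auto simp: p_def p'_def)
  have p'_diff: "(\<lambda>n. norm (p' n - p n)) sums (\<Sum>n\<in>{1..N}. norm (c n) * \<bar>real n powr \<epsilon> - 1\<bar>)"
  proof -
    have eq: "norm (p' n - p n) = norm (p n) * \<bar>real n powr \<epsilon> - 1\<bar>" for n
    proof -
      have "p' n - p n = p n * of_real (real n powr \<epsilon> - 1)"
        by (simp add: p'_def right_diff_distrib)
      then show ?thesis by (simp only: norm_mult norm_of_real)
    qed
    have "norm (p' n - p n) = 0" if "n \<notin> {1..N}" for n
      using that c0 unfolding eq by (cases "n = 0") (auto simp: p_def)
    then have "(\<lambda>n. norm (p' n - p n)) sums (\<Sum>n\<in>{1..N}. norm (p' n - p n))"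
      by (intro sums_finite) auto
    also have "(\<Sum>n\<in>{1..N}. norm (p' n - p n)) = (\<Sum>n\<in>{1..N}. norm (c n) * \<bar>real n powr \<epsilon> - 1\<bar>)"
      unfolding eq by (rule sum.cong) (auto simp: p_def)
    finally show ?thesis .
  qed
  have close: "norm (dirichlet p' s - dirichlet c s) \<le> 2 * \<eta>" if s: "0 < Re s" for s
  proof -
    have le: "norm (p' n - c n) \<le> norm (p' n - p n) + norm (q n)" for n
      using norm_triangle_ineq4[of "p' n - p n" "q n"] by (auto simp: p_def q_def split: if_splits)
    have sm': "summable (\<lambda>n. norm (p' n - p n) + norm (q n))"
      using p'_diff smq by (intro summable_add) (auto simp: sums_iff)
    have smd: "summable (\<lambda>n. norm (p' n - c n))"
      by (rule summable_comparison_test'[OF sm', of 0]) (use le in simp)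
    have "norm (dirichlet p' s - dirichlet c s) = norm (dirichlet (\<lambda>n. p' n - c n) s)"
      using s by (simp add: dirichlet_diff smp' sm)
    also have "\<dots> \<le> (\<Sum>n. norm (p' n - c n))" using s by (intro norm_dirichlet_le smd) simp
    also have "\<dots> \<le> (\<Sum>n. norm (p' n - p n) + norm (q n))" by (intro suminf_le le smd sm')
    also have "\<dots> = (\<Sum>n. norm (p' n - p n)) + (\<Sum>n. norm (q n))"
      by (rule suminf_add[symmetric]) (use p'_diff smq in \<open>auto simp: sums_iff\<close>)
    finally show ?thesis using q_sum \<epsilon>(2) p'_diff by (simp add: sums_iff)
  qed
  define Z where "Z = (\<Sum>n. if n \<in> smooth N then real n powr (- \<epsilon>) else 0)"
  have "Aplus_le UNIV (\<lambda>s. exp (- of_real t * dirichlet c s)) (Z * exp (- t * \<gamma>))" if t: "0 \<le> t" for t :: real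
  proof -
    let ?K = "exp (- t * (\<delta> - 2 * \<eta>))"
    have "Aplus_le (smooth N) (dirichlet p') (\<Sum>n. norm (p' n))"
    proof (rule Aplus_le_dirichlet[OF _ smp'])
      show "n \<in> smooth N" if "p' n \<noteq> 0" for n
        using that c0 by (intro le_in_smooth; cases "n = 0") (auto simp: p'_def p_def split: if_splits)
    qed (simp add: p'_def p_def c0)
    then have "Aplus_le (smooth N) (\<lambda>s. exp (- of_real t * dirichlet p' s))
        (exp (norm (- of_real t :: complex) * (\<Sum>n. norm (p' n))))"
      by (intro Aplus_le_exp Aplus_le_cmult one_in_smooth smooth_mult)
    then obtain b where b: "dser_rep b (\<lambda>s. exp (- of_real t * dirichlet p' s))"
        "\<And>n. b n \<noteq> 0 \<Longrightarrow> n \<in> smooth N"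
      unfolding Aplus_le_def by blast
    \<comment> \<open>The growth \<open>exp (t * \<kappa> * Re s)\<close> is of the kind that
      \<open>dser_rep_coeff_bound\<close> absorbs, so only \<open>\<delta> - 2 * \<eta>\<close>
      enters the bound.\<close>
    have "norm (b n) \<le> ?K" for n
    proof (rule dser_rep_coeff_bound[OF b(1), of _ "t * \<kappa>"])
      fix s :: complex assume s: "0 < Re s"
      have "\<delta> - \<kappa> * Re s - 2 * \<eta> \<le> Re (dirichlet p' s)"
        using close[OF s] \<kappa>[OF s] abs_Re_le_cmod[of "dirichlet p' s - dirichlet c s"] by simp
      then have "- t * Re (dirichlet p' s) \<le> - t * (\<delta> - \<kappa> * Re s - 2 * \<eta>)"
        using t by (intro mult_left_mono_neg) auto
      also have "\<dots> = - t * (\<delta> - 2 * \<eta>) + t * \<kappa> * Re s" by (simp add: algebra_simps)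
      finally show "norm (exp (- of_real t * dirichlet p' s)) \<le> ?K * exp (t * \<kappa> * Re s)"
        unfolding exp_add[symmetric] by simp
    qed
    from Aplus_le_translate[OF b this smooth_powr_summable[OF \<epsilon>(1)] \<epsilon>(1)]
    have "Aplus_le UNIV (\<lambda>s. exp (- of_real t * dirichlet p' (s + of_real \<epsilon>))) (?K * Z)"
      unfolding Z_def by (rule Aplus_le_mono) auto
    then have p_le: "Aplus_le UNIV (\<lambda>s. exp (- of_real t * dirichlet p s)) (?K * Z)"
      unfolding p'_def[abs_def] dirichlet_translate by simp
    have "Aplus_le UNIV (dirichlet q) (\<Sum>n. norm (q n))"
      by (rule Aplus_le_dirichlet[OF _ smq]) (auto simp: q_def)
    then have "Aplus_le UNIV (\<lambda>s. exp (- of_real t * dirichlet q s))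
        (exp (norm (- of_real t :: complex) * (\<Sum>n. norm (q n))))"
      by (intro Aplus_le_exp Aplus_le_cmult) auto
    then have q_le: "Aplus_le UNIV (\<lambda>s. exp (- of_real t * dirichlet q s)) (exp (t * \<eta>))"
      by (rule Aplus_le_mono) (use t q_sum in \<open>auto intro: mult_left_mono\<close>)
    have "Aplus_le UNIV (\<lambda>s. exp (- of_real t * dirichlet p s) * exp (- of_real t * dirichlet q s))
        (?K * Z * exp (t * \<eta>))"
      by (rule Aplus_le_mult[OF p_le q_le]) simp
    then have "Aplus_le UNIV (\<lambda>s. exp (- of_real t * dirichlet c s)) (?K * Z * exp (t * \<eta>))"
    proof (rule Aplus_le_cong)
      fix s :: complex assume s: "0 < Re s"
      have "q = (\<lambda>n. c n - p n)" by (auto simp: p_def q_def)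
      then have "dirichlet c s = dirichlet p s + dirichlet q s"
        using s by (simp add: dirichlet_diff sm smp)
      then show "exp (- of_real t * dirichlet p s) * exp (- of_real t * dirichlet q s) =
          exp (- of_real t * dirichlet c s)"
        by (simp add: exp_add[symmetric] algebra_simps)
    qed
    moreover have "?K * Z * exp (t * \<eta>) = Z * exp (- t * \<gamma>)"
    proof -
      have "?K * exp (t * \<eta>) = exp (- t * \<gamma>)"
        unfolding exp_add[symmetric] by (simp add: \<eta>_def field_simps)
      then show ?thesis by (metis mult.assoc mult.commute)
    qed
    ultimately show ?thesis by (simp only:)
  qed
  then show ?thesis by blast
qed

text \<open>With \<open>t = ln (real n)\<close>, \<open>npow \<phi> n\<close> is the product of the
  monomial with base \<open>n ^ c0\<close> and the exponential of \<open>- t\<close> times the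
  series. The monomial is a norm-preserving shift, so exponential decay with
  \<open>\<gamma> = \<delta> / 2\<close> gives decay like
  \<open>real n powr (- (\<delta> / 2))\<close>.\<close>

lemma npow_affine_dirichlet_tendsto_0:
  assumes sm: "summable (\<lambda>n. norm (c n))"
    and eq: "\<And>s. 0 < Re s \<Longrightarrow> \<phi> s = of_nat c0 * s + dirichlet c s"
    and \<delta>: "0 < \<delta>" "\<phi> ` halfplane 0 \<subseteq> halfplane \<delta>"
  shows "1 \<le> n \<Longrightarrow> in_Aplus (npow \<phi> n)" and "(\<lambda>n. Aplus_norm (npow \<phi> n)) \<longlonglongrightarrow> 0"
proof -
  \<comment> \<open>The term at index 0 vanishes whatever \<open>c 0\<close> is; resetting it to 0
    meets the normalisation in \<open>exp_dirichlet_decay\<close>.\<close>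
  define c' where "c' n = (if n = 0 then 0 else c n)" for n
  have c'_eq: "dirichlet c' s = dirichlet c s" for s
    unfolding dirichlet_def by (rule suminf_cong) (simp add: c'_def)
  have "summable (\<lambda>n. norm (c' n))"
    by (rule summable_comparison_test'[OF sm, of 0]) (simp add: c'_def)
  \<comment> \<open>Moving the linear part of \<open>\<phi>\<close> to the other side leaves a loss
    linear in \<open>Re s\<close>, with \<open>\<kappa> = real c0\<close>.\<close>
  moreover have "\<delta> - real c0 * Re s \<le> Re (dirichlet c' s)" if "0 < Re s" for s
  proof -
    have "\<delta> < Re (\<phi> s)" using that \<delta>(2) by (auto simp: halfplane_def)
    then show ?thesis using eq[OF that] by (simp add: c'_eq)
  qed
  ultimately obtain Z where Z: "\<And>t. 0 \<le> t \<Longrightarrow>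
      Aplus_le UNIV (\<lambda>s. exp (- of_real t * dirichlet c' s)) (Z * exp (- t * (\<delta> / 2)))"
    using exp_dirichlet_decay[of c' \<delta> "real c0" "\<delta> / 2"] \<delta>(1) by (auto simp: c'_def)
  have le: "Aplus_le UNIV (npow \<phi> n) (Z * real n powr (- (\<delta> / 2)))" if n: "1 \<le> n" for n
  proof -
    have "Aplus_le UNIV (\<lambda>s. of_nat (n ^ c0) powr (- s) * exp (- of_real (ln (real n)) * dirichlet c' s))
        (Z * exp (- ln (real n) * (\<delta> / 2)))"
      using n by (intro Aplus_le_shift Z) auto
    moreover have "exp (- ln (real n) * (\<delta> / 2)) = real n powr (- (\<delta> / 2))"
      using n by (simp add: powr_def mult.commute)
    ultimately have "Aplus_le UNIV (\<lambda>s. of_nat (n ^ c0) powr (- s) *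
        exp (- of_real (ln (real n)) * dirichlet c' s)) (Z * real n powr (- (\<delta> / 2)))"
      by simp
    then show ?thesis
    proof (rule Aplus_le_cong)
      fix s :: complex assume s: "0 < Re s"
      have "(of_nat (n ^ c0) :: complex) powr (- s) = exp (- s * of_real (ln (real (n ^ c0))))"
        using n Ln_of_nat[of "n ^ c0"] by (simp add: powr_def)
      also have "ln (real (n ^ c0)) = real c0 * ln (real n)"
        using n by (simp add: ln_realpow)
      finally show "of_nat (n ^ c0) powr (- s) * exp (- of_real (ln (real n)) * dirichlet c' s)
          = npow \<phi> n s"
        using n by (simp add: npow_def powr_def Ln_of_nat eq[OF s] c'_eq exp_add[symmetric] algebra_simps)
    qed
  qed
  show inA: "in_Aplus (npow \<phi> n)" if "1 \<le> n" for n
    by (rule Aplus_le_imp_in_Aplus[OF le[OF that]])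
  have "\<forall>\<^sub>F n in sequentially. norm (Aplus_norm (npow \<phi> n)) \<le> Z * real n powr (- (\<delta> / 2))"
    using eventually_ge_at_top[of 1]
    by eventually_elim (use Aplus_norm_nonneg[OF inA] Aplus_le_imp_norm_le[OF le] in simp)
  moreover have "(\<lambda>n. Z * real n powr (- (\<delta> / 2))) \<longlonglongrightarrow> 0"
    using \<delta>(1) by (intro tendsto_mult_right_zero tendsto_neg_powr filterlim_real_sequentially) simp
  ultimately show "(\<lambda>n. Aplus_norm (npow \<phi> n)) \<longlonglongrightarrow> 0"
    by (rule Lim_null_comparison)
qed

section \<open>The equivalences from the separate implications\<close>

theorem theorem3:
  fixes \<phi> \<psi> :: "complex \<Rightarrow> complex" and c0 :: nat
  assumes hol: "\<phi> holomorphic_on halfplane 0"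
    and nonconst: "\<not> (\<exists>k. \<forall>s\<in>halfplane 0. \<phi> s = k)"
    and psiD: "\<psi> \<in> Dclass"
    and decomp: "\<forall>s\<in>halfplane 0. \<phi> s = of_nat c0 * s + \<psi> s"
  shows
    "(Cphi_maps_Aplus \<phi> \<longrightarrow>
        (\<forall>n\<ge>1. in_Aplus (npow \<phi> n)) \<and>
        (\<exists>C>0. \<forall>n\<ge>1. Aplus_norm (npow \<phi> n) \<le> C))
   \<and> (((\<forall>n\<ge>1. in_Aplus (npow \<phi> n)) \<and> (\<exists>B. \<forall>n\<ge>1. Aplus_norm (npow \<phi> n) \<le> B)) \<longrightarrow>
        \<phi> ` halfplane 0 \<subseteq> halfplane 0 \<and> Cphi_bounded \<phi>)
   \<and> (Cphi_compact \<phi> \<longleftrightarrow>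
        (\<forall>n\<ge>1. in_Aplus (npow \<phi> n)) \<and> (\<lambda>n. Aplus_norm (npow \<phi> n)) \<longlonglongrightarrow> 0)
   \<and> (Cphi_compact \<phi> \<longrightarrow> (\<exists>\<delta>>0. \<phi> ` halfplane 0 \<subseteq> halfplane \<delta>))
   \<and> ((\<exists>c. summable (\<lambda>n. norm (c n)) \<and>
          (\<forall>s\<in>halfplane 0. \<phi> s = of_nat c0 * s + dirichlet c s)) \<longrightarrow>
        (Cphi_compact \<phi> \<longleftrightarrow> (\<exists>\<delta>>0. \<phi> ` halfplane 0 \<subseteq> halfplane \<delta>)))"
proof -
  \<comment> \<open>\<open>Cphi_maps_Aplus\<close> only gives \<open>0 \<le> Re (\<phi> s)\<close>;
    non-constancy and the open mapping theorem make the inequality strict.\<close>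
  have pos: "0 < Re (\<phi> s)" if "Cphi_maps_Aplus \<phi>" "0 < Re s" for s
    using halfplane_image_open_mapping[OF hol nonconst] that
    by (auto simp: Cphi_maps_Aplus_def halfplane_def)
  have a1: "(\<forall>n\<ge>1. in_Aplus (npow \<phi> n)) \<and> (\<exists>C>0. \<forall>n\<ge>1. Aplus_norm (npow \<phi> n) \<le> C)"
    if "Cphi_maps_Aplus \<phi>"
    using npow_in_Aplus[OF that] Cphi_maps_imp_npow_bounded[OF that pos[OF that]] by blast
  have a2: "\<phi> ` halfplane 0 \<subseteq> halfplane 0 \<and> Cphi_bounded \<phi>"
    if "\<forall>n\<ge>1. in_Aplus (npow \<phi> n)" "\<forall>n\<ge>1. Aplus_norm (npow \<phi> n) \<le> B" for B
  proof -
    have le: "Aplus_le UNIV (npow \<phi> n) B" if "1 \<le> n" for n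
      using \<open>\<forall>n\<ge>1. in_Aplus (npow \<phi> n)\<close> \<open>\<forall>n\<ge>1. Aplus_norm (npow \<phi> n) \<le> B\<close> that
      by (intro Aplus_le_mono[OF Aplus_le_norm]) auto
    have "Cphi_bounded \<phi>" by (rule npow_bounded_imp_Cphi_bounded[OF le])
    moreover from this have "Cphi_maps_Aplus \<phi>" by (simp add: Cphi_bounded_def)
    ultimately show ?thesis using pos by (auto simp: halfplane_def)
  qed
  have b1: "(\<forall>n\<ge>1. in_Aplus (npow \<phi> n)) \<and> (\<lambda>n. Aplus_norm (npow \<phi> n)) \<longlonglongrightarrow> 0"
    if "Cphi_compact \<phi>"
  proof -
    have maps: "Cphi_maps_Aplus \<phi>" using that by (simp add: Cphi_compact_def)
    show ?thesis
      using npow_in_Aplus[OF maps] compact_imp_npow_tendsto_0[OF that pos[OF maps]] by blast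
  qed
  have b2: "Cphi_compact \<phi>"
    if "\<forall>n\<ge>1. in_Aplus (npow \<phi> n)" "(\<lambda>n. Aplus_norm (npow \<phi> n)) \<longlonglongrightarrow> 0"
    by (rule npow_tendsto_0_imp_compact) (use that in auto)
  have b3: "\<exists>\<delta>>0. \<phi> ` halfplane 0 \<subseteq> halfplane \<delta>" if "Cphi_compact \<phi>"
    by (rule npow_tendsto_0_imp_halfplane) (use b1[OF that] in auto)
  have b4: "Cphi_compact \<phi>"
    if "summable (\<lambda>n. norm (c n))" "\<forall>s\<in>halfplane 0. \<phi> s = of_nat c0 * s + dirichlet c s"
      "0 < \<delta>" "\<phi> ` halfplane 0 \<subseteq> halfplane \<delta>" for c \<delta>
    using npow_affine_dirichlet_tendsto_0[of c \<phi> c0 \<delta>] that b2 by (simp add: halfplane_def)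
  show ?thesis
  proof (intro conjI)
    show "Cphi_maps_Aplus \<phi> \<longrightarrow> (\<forall>n\<ge>1. in_Aplus (npow \<phi> n)) \<and>
        (\<exists>C>0. \<forall>n\<ge>1. Aplus_norm (npow \<phi> n) \<le> C)"
      by (rule impI) (rule a1)
    show "(\<forall>n\<ge>1. in_Aplus (npow \<phi> n)) \<and> (\<exists>B. \<forall>n\<ge>1. Aplus_norm (npow \<phi> n) \<le> B) \<longrightarrow>
        \<phi> ` halfplane 0 \<subseteq> halfplane 0 \<and> Cphi_bounded \<phi>"
      by (intro impI, elim conjE exE, rule a2)
    show "Cphi_compact \<phi> \<longleftrightarrow>
        (\<forall>n\<ge>1. in_Aplus (npow \<phi> n)) \<and> (\<lambda>n. Aplus_norm (npow \<phi> n)) \<longlonglongrightarrow> 0"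
      by (intro iffI, erule b1, elim conjE, rule b2)
    show "Cphi_compact \<phi> \<longrightarrow> (\<exists>\<delta>>0. \<phi> ` halfplane 0 \<subseteq> halfplane \<delta>)"
      by (rule impI) (rule b3)
    show "(\<exists>c. summable (\<lambda>n. norm (c n)) \<and>
          (\<forall>s\<in>halfplane 0. \<phi> s = of_nat c0 * s + dirichlet c s)) \<longrightarrow>
        (Cphi_compact \<phi> \<longleftrightarrow> (\<exists>\<delta>>0. \<phi> ` halfplane 0 \<subseteq> halfplane \<delta>))"
      by (intro impI iffI, erule b3, elim exE conjE, rule b4)
  qed
qed

end
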